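(* Let $\nu\in\mathbb R$ with $\nu^2\notin\mathrm{Sp}(-\nabla\mathrm{div})$, let $k>0$ be an integer and let $m$ be an integer. Then the operator $\nabla\mathrm{div}+\nu^2I$ maps the class $\mathbf C(2(k+1),m)$ onto $\mathbf C(2k,m)$ bijectively and continuously.
   Context: $\Omega\subset\mathbb R^3$ is a bounded domain with smooth boundary, homeomorphic to a ball; $\mathbf n$ is the unit normal, $\gamma$ the boundary trace; $\mathbf L_2(\Omega)$ is the real Hilbert space of square integrable vector fields with inner product $(\cdot,\cdot)$. $\mathcal A=\{\nabla h:h\in H^1(\Omega)\}$, and $\mathcal B=\mathbf V^0$ is its orthogonal complement in $\mathbf L_2(\Omega)$. $\{\mathbf q_j\}$ is an orthonormal basis of $\mathcal A$ with $\mathbf q_j\in\mathbf C^\infty(\overline\Omega)$, $-\nabla\mathrm{div}\,\mathbf q_j=\nu_j^2\mathbf q_j$, $\gamma(\mathbf n\cdot\mathbf q_j)=0$, $0<\nu_1^2\le\nu_2^2\le\dots$. Standing convention: the eigenvalues of the self-adjoint operator $S\mathbf f=\mathrm{rot}\,\mathbf f$ in $\mathbf V^0$ (domain $\{\mathbf f\in\mathbf V^0:\mathrm{rot}\,\mathbf f\in\mathbf V^0\}$) come in pairs $\pm\lambda_j$, $0<\lambda_1\le\lambda_2\le\dots$, and $\{\mathbf q_j^+,\mathbf q_j^-\}$ is an orthonormal basis of $\mathbf V^0$ with $\mathrm{rot}\,\mathbf q_j^\pm=\pm\lambda_j\mathbf q_j^\pm$, $\gamma(\mathbf n\cdot\mathbf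 q_j^\pm)=0$. For an integer $k\ge0$, $\mathbf A^{2k}=\{\mathbf f\in\mathcal A:\sum_j\nu_j^{4k}(\mathbf f,\mathbf q_j)^2<\infty\}$ with that sum as norm squared. For an integer $m$, $\mathbf W^m$ is the Hilbert space of coefficient sequences $f_j^\pm=(\mathbf f,\mathbf q_j^\pm)$ with norm squared $\sum_j\lambda_j^{2m}[(f_j^+)^2+(f_j^-)^2]<\infty$ (for $m\ge0$ this is $\{\mathbf f\in\mathbf V^0,\dots,\mathrm{rot}^m\mathbf f\in\mathbf V^0\}$; for $m<0$, functionals). $\mathbf C(2k,m)=\mathbf A^{2k}\oplus\mathbf W^m$. $\nabla\mathrm{div}$ acts on the $\mathbf A$ component as $\mathcal N_d\mathbf f=-\sum_j\nu_j^2(\mathbf f,\mathbf q_j)\mathbf q_j$ and annihilates the $\mathbf W^m$ component, so $(\nabla\mathrm{div}+\nu^2I)(\mathbf w_{\mathcal A}+\mathbf w_{\mathbf V})=(\mathcal N_d+\nu^2I)\mathbf w_{\mathcal A}+\nu^2\mathbf w_{\mathbf V}$. $\mathrm{Sp}(-\nabla\mathrm{div})$ is the set of real $\mu$ for which $-\nabla\mathrm{div}\,\mathbf v=\mu\mathbf v$ in $\Omega$, $\gamma(\mathbf n\cdot\mathbf v)=0$, has a nonzero solution, i.e. $\{0\}\cup\{\nu_j^2\}$. *)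

theory Defs
  imports "HOL-Analysis.Analysis"
begin

section \<open>The Hilbert space of square integrable functions on three-space\<close>

definition sq_integrable :: "(real^3 \<Rightarrow> 'a::euclidean_space) \<Rightarrow> bool" where
  "sq_integrable f \<longleftrightarrow>
     f \<in> borel_measurable lebesgue \<and> integrable lebesgue (\<lambda>x. (norm (f x))\<^sup>2)"

lemma sq_integrable_zero: "sq_integrable (\<lambda>x. 0)"
  by (simp add: sq_integrable_def)

lemma sq_integrable_inner:
  assumes "sq_integrable f" "sq_integrable g"
  shows "integrable lebesgue (\<lambda>x. f x \<bullet> g x)"
proof (rule Bochner_Integration.integrable_bound)
  show "integrable lebesgue (\<lambda>x. (norm (f x))\<^sup>2 + (norm (g x))\<^sup>2)"
    using assms by (simp add: sq_integrable_def)
  show "(\<lambda>x. f x \<bullet> g x) \<in> borel_measurable lebesgue"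
    using assms by (auto simp: sq_integrable_def intro: borel_measurable_inner)
  have "norm (f x \<bullet> g x) \<le> norm ((norm (f x))\<^sup>2 + (norm (g x))\<^sup>2)" for x
  proof -
    have "\<bar>f x \<bullet> g x\<bar> \<le> norm (f x) * norm (g x)"
      by (rule Cauchy_Schwarz_ineq2)
    also have "\<dots> \<le> (norm (f x))\<^sup>2 + (norm (g x))\<^sup>2"
      using sum_squares_bound[of "norm (f x)" "norm (g x)"]
        mult_nonneg_nonneg[OF norm_ge_zero norm_ge_zero, of "f x" "g x"] by linarith
    finally show ?thesis by simp
  qed
  then show "AE x in lebesgue. norm (f x \<bullet> g x) \<le> norm ((norm (f x))\<^sup>2 + (norm (g x))\<^sup>2)"
    by simp
qed

lemma sq_integrable_add:
  assumes "sq_integrable f" "sq_integrable g"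
  shows "sq_integrable (\<lambda>x. f x + g x)"
proof -
  have "integrable lebesgue (\<lambda>x. (norm (f x))\<^sup>2 + 2 * (f x \<bullet> g x) + (norm (g x))\<^sup>2)"
    using assms sq_integrable_inner[OF assms] by (simp add: sq_integrable_def)
  moreover have "(norm (f x + g x))\<^sup>2 = (norm (f x))\<^sup>2 + 2 * (f x \<bullet> g x) + (norm (g x))\<^sup>2" for x
    by (simp add: power2_norm_eq_inner inner_add inner_commute)
  moreover have "(\<lambda>x. f x + g x) \<in> borel_measurable lebesgue"
    using assms by (intro borel_measurable_add) (auto simp: sq_integrable_def)
  ultimately show ?thesis
    by (simp add: sq_integrable_def)
qed

lemma sq_integrable_scaleR:
  assumes "sq_integrable f"
  shows "sq_integrable (\<lambda>x. c *\<^sub>R f x)"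
proof -
  have "(\<lambda>x. c *\<^sub>R f x) \<in> borel_measurable lebesgue"
    using assms by (intro borel_measurable_scaleR borel_measurable_const) (auto simp: sq_integrable_def)
  then show ?thesis
    using assms by (simp add: sq_integrable_def power_mult_distrib)
qed

definition L2_rel :: "(real^3 \<Rightarrow> 'a::euclidean_space) \<Rightarrow> (real^3 \<Rightarrow> 'a) \<Rightarrow> bool" where
  "L2_rel f g \<longleftrightarrow> sq_integrable f \<and> sq_integrable g \<and> (AE x in lebesgue. f x = g x)"

quotient_type (overloaded) 'a L2 = "real^3 \<Rightarrow> 'a::euclidean_space" / partial: L2_rel
proof (rule part_equivpI)
  show "\<exists>f::real^3 \<Rightarrow> 'a. L2_rel f f"
    using sq_integrable_zero by (auto simp: L2_rel_def)
  show "symp (L2_rel :: (real^3 \<Rightarrow> 'a) \<Rightarrow> _)"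
    by (auto simp: symp_def L2_rel_def eq_commute)
  show "transp (L2_rel :: (real^3 \<Rightarrow> 'a) \<Rightarrow> _)"
    by (auto simp: transp_def L2_rel_def elim: AE_mp)
qed

instantiation L2 :: (euclidean_space) real_inner
begin

lift_definition zero_L2 :: "'a L2" is "\<lambda>x. 0"
  by (simp add: L2_rel_def sq_integrable_zero)

lift_definition plus_L2 :: "'a L2 \<Rightarrow> 'a L2 \<Rightarrow> 'a L2" is "\<lambda>f g x. f x + g x"
  by (auto simp: L2_rel_def intro!: sq_integrable_add elim: AE_mp)

lift_definition scaleR_L2 :: "real \<Rightarrow> 'a L2 \<Rightarrow> 'a L2" is "\<lambda>c f x. c *\<^sub>R f x"
  by (auto simp: L2_rel_def intro!: sq_integrable_scaleR elim: AE_mp)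

lift_definition inner_L2 :: "'a L2 \<Rightarrow> 'a L2 \<Rightarrow> real" is "\<lambda>f g. \<integral>x. f x \<bullet> g x \<partial>lebesgue"
proof -
  fix f f' g g' :: "real^3 \<Rightarrow> 'a"
  assume f: "L2_rel f f'" and g: "L2_rel g g'"
  show "(\<integral>x. f x \<bullet> g x \<partial>lebesgue) = (\<integral>x. f' x \<bullet> g' x \<partial>lebesgue)"
  proof (rule integral_cong_AE)
    show "AE x in lebesgue. f x \<bullet> g x = f' x \<bullet> g' x"
      using f g by (auto simp: L2_rel_def elim: AE_mp)
  qed (use f g in \<open>auto simp: L2_rel_def sq_integrable_def intro: borel_measurable_inner\<close>)
qed

definition uminus_L2 :: "'a L2 \<Rightarrow> 'a L2" where "uminus_L2 F = (-1) *\<^sub>R F"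
definition minus_L2 :: "'a L2 \<Rightarrow> 'a L2 \<Rightarrow> 'a L2" where "minus_L2 F G = F + - G"
definition norm_L2 :: "'a L2 \<Rightarrow> real" where "norm_L2 F = sqrt (inner F F)"
definition sgn_L2 :: "'a L2 \<Rightarrow> 'a L2" where "sgn_L2 F = inverse (norm F) *\<^sub>R F"
definition dist_L2 :: "'a L2 \<Rightarrow> 'a L2 \<Rightarrow> real" where "dist_L2 F G = norm (F - G)"
definition uniformity_L2 :: "('a L2 \<times> 'a L2) filter" where
  "uniformity_L2 = (INF e\<in>{0 <..}. principal {(F, G). dist F G < e})"
definition open_L2 :: "'a L2 set \<Rightarrow> bool" where
  "open_L2 U \<longleftrightarrow> (\<forall>F\<in>U. eventually (\<lambda>(F', G). F' = F \<longrightarrow> G \<in> U) uniformity)"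

instance
proof
  fix F G H :: "'a L2" and r s :: real
  show "F + G + H = F + (G + H)"
    by transfer (auto simp: L2_rel_def add.assoc intro!: sq_integrable_add)
  show "F + G = G + F"
    by transfer (auto simp: L2_rel_def add.commute intro!: sq_integrable_add)
  show "0 + F = F"
    by transfer (auto simp: L2_rel_def)
  show "- F + F = 0"
    unfolding uminus_L2_def
    by transfer (auto simp: L2_rel_def sq_integrable_zero)
  show "F - G = F + - G"
    by (simp add: minus_L2_def)
  show "r *\<^sub>R (F + G) = r *\<^sub>R F + r *\<^sub>R G"
    by transfer (auto simp: L2_rel_def scaleR_add_right intro!: sq_integrable_add sq_integrable_scaleR)
  show "(r + s) *\<^sub>R F = r *\<^sub>R F + s *\<^sub>R F"
    by transfer (auto simp: L2_rel_def scaleR_add_left intro!: sq_integrable_add sq_integrable_scaleR)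
  show "r *\<^sub>R s *\<^sub>R F = (r * s) *\<^sub>R F"
    by transfer (auto simp: L2_rel_def intro!: sq_integrable_scaleR)
  show "1 *\<^sub>R F = F"
    by transfer (auto simp: L2_rel_def)
  show "sgn F = inverse (norm F) *\<^sub>R F"
    by (rule sgn_L2_def)
  show "dist F G = norm (F - G)"
    by (rule dist_L2_def)
  show "F \<bullet> G = G \<bullet> F"
    by transfer (simp add: inner_commute)
  show "(F + G) \<bullet> H = F \<bullet> H + G \<bullet> H"
    by transfer (auto simp: L2_rel_def inner_add_left sq_integrable_inner)
  show "(r *\<^sub>R F) \<bullet> G = r * (F \<bullet> G)"
    by transfer simp
  show "0 \<le> F \<bullet> F"
    by transfer simp
  show "(F \<bullet> F = 0) = (F = 0)"
  proof transfer
    fix f :: "real^3 \<Rightarrow> 'a"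
    assume "L2_rel f f"
    then have f: "sq_integrable f" by (simp add: L2_rel_def)
    have "((\<integral>x. f x \<bullet> f x \<partial>lebesgue) = 0) = (AE x in lebesgue. f x \<bullet> f x = 0)"
      by (rule integral_nonneg_eq_0_iff_AE) (use sq_integrable_inner[OF f f] in auto)
    then show "((\<integral>x. f x \<bullet> f x \<partial>lebesgue) = 0) = L2_rel f (\<lambda>x. 0)"
      using f by (simp add: L2_rel_def sq_integrable_zero)
  qed
  show "norm F = sqrt (F \<bullet> F)"
    by (rule norm_L2_def)
  show "(uniformity :: ('a L2 \<times> 'a L2) filter) = (INF e\<in>{0 <..}. principal {(F, G). dist F G < e})"
    by (rule uniformity_L2_def)
  show "open U = (\<forall>F\<in>U. eventually (\<lambda>(F', G). F' = F \<longrightarrow> G \<in> U) uniformity)" for U :: "'a L2 set"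
    by (rule open_L2_def)
qed

end

text \<open>Junk value \<open>0\<close> for functions that are not square integrable.\<close>

definition L2_of :: "(real^3 \<Rightarrow> 'a::euclidean_space) \<Rightarrow> 'a L2" where
  "L2_of f = (if sq_integrable f then abs_L2 f else 0)"

text \<open>\<open>L\<^sub>2(\<Omega>)\<close>, embedded by extension by zero.\<close>

definition L2_on :: "(real^3) set \<Rightarrow> 'a::euclidean_space L2 set" where
  "L2_on \<Omega> = {L2_of f | f. sq_integrable f \<and> (\<forall>x. x \<notin> \<Omega> \<longrightarrow> f x = 0)}"


section \<open>Smooth functions and smooth domains\<close>

definition pd :: "3 \<Rightarrow> (real^3 \<Rightarrow> 'a::real_normed_vector) \<Rightarrow> real^3 \<Rightarrow> 'a" where
  "pd i f x = frechet_derivative f (at x) (axis i 1)"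

text \<open>\<open>C\<^sup>n\<close> functions on an open set.\<close>

fun Ck_on :: "nat \<Rightarrow> (real^3) set \<Rightarrow> (real^3 \<Rightarrow> 'a::real_normed_vector) \<Rightarrow> bool" where
  "Ck_on 0 U f \<longleftrightarrow> continuous_on U f"
| "Ck_on (Suc n) U f \<longleftrightarrow> (\<forall>x\<in>U. f differentiable at x) \<and> (\<forall>i. Ck_on n U (pd i f))"

definition smooth_on :: "(real^3) set \<Rightarrow> (real^3 \<Rightarrow> 'a::real_normed_vector) \<Rightarrow> bool" where
  "smooth_on U f \<longleftrightarrow> (\<forall>n. Ck_on n U f)"

text \<open>Locally \<open>\<Omega>\<close> lies on one side of a regular level set of a smooth function.\<close>

definition smooth_boundary :: "(real^3) set \<Rightarrow> bool" where
  "smooth_boundary \<Omega> \<longleftrightarrow>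
     (\<forall>p\<in>frontier \<Omega>. \<exists>U (\<rho> :: real^3 \<Rightarrow> real). open U \<and> p \<in> U \<and> smooth_on U \<rho> \<and>
        (\<forall>x\<in>U. \<exists>i. pd i \<rho> x \<noteq> 0) \<and> \<Omega> \<inter> U = {x\<in>U. \<rho> x < 0})"

definition smooth_ball_domain :: "(real^3) set \<Rightarrow> bool" where
  "smooth_ball_domain \<Omega> \<longleftrightarrow>
     open \<Omega> \<and> connected \<Omega> \<and> bounded \<Omega> \<and> smooth_boundary \<Omega> \<and>
     \<Omega> homeomorphic (ball 0 1 :: (real^3) set)"

text \<open>\<open>C\<^sup>\<infinity>\<close> up to the boundary: restrictions to \<open>\<Omega>\<close> of smooth functions on the whole space.\<close>

definition smooth_upto_boundary :: "(real^3) set \<Rightarrow> 'a::euclidean_space L2 \<Rightarrow> bool" where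
  "smooth_upto_boundary \<Omega> F \<longleftrightarrow>
     (\<exists>f. smooth_on UNIV f \<and> F = L2_of (\<lambda>x. if x \<in> \<Omega> then f x else 0))"


section \<open>Weak derivatives and the normal trace\<close>

definition gradient :: "(real^3 \<Rightarrow> real) \<Rightarrow> real^3 \<Rightarrow> real^3" where
  "gradient f x = (\<chi> i. pd i f x)"

definition divergence :: "(real^3 \<Rightarrow> real^3) \<Rightarrow> real^3 \<Rightarrow> real" where
  "divergence v x = (\<Sum>i\<in>UNIV. pd i v x $ i)"

definition curl :: "(real^3 \<Rightarrow> real^3) \<Rightarrow> real^3 \<Rightarrow> real^3" where
  "curl v x = vector [pd 2 v x $ 3 - pd 3 v x $ 2,
                      pd 3 v x $ 1 - pd 1 v x $ 3,
                      pd 1 v x $ 2 - pd 2 v x $ 1]"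

text \<open>Testing against compactly supported \<open>C\<^sup>1\<close> functions gives the same weak derivatives
  as testing against compactly supported \<open>C\<^sup>\<infinity>\<close> functions.\<close>

definition test_functions :: "(real^3) set \<Rightarrow> (real^3 \<Rightarrow> 'a::euclidean_space) set" where
  "test_functions \<Omega> =
     {\<phi>. Ck_on 1 UNIV \<phi> \<and> compact (closure {x. \<phi> x \<noteq> 0}) \<and> closure {x. \<phi> x \<noteq> 0} \<subseteq> \<Omega>}"

definition has_weak_grad :: "(real^3) set \<Rightarrow> real L2 \<Rightarrow> (real^3) L2 \<Rightarrow> bool" where
  "has_weak_grad \<Omega> H G \<longleftrightarrow> H \<in> L2_on \<Omega> \<and> G \<in> L2_on \<Omega> \<and>
     (\<forall>\<phi>\<in>test_functions \<Omega>. G \<bullet> L2_of \<phi> = - (H \<bullet> L2_of (divergence \<phi>)))"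

definition has_weak_div :: "(real^3) set \<Rightarrow> (real^3) L2 \<Rightarrow> real L2 \<Rightarrow> bool" where
  "has_weak_div \<Omega> V D \<longleftrightarrow> V \<in> L2_on \<Omega> \<and> D \<in> L2_on \<Omega> \<and>
     (\<forall>\<phi>\<in>test_functions \<Omega>. D \<bullet> L2_of \<phi> = - (V \<bullet> L2_of (gradient \<phi>)))"

definition has_weak_rot :: "(real^3) set \<Rightarrow> (real^3) L2 \<Rightarrow> (real^3) L2 \<Rightarrow> bool" where
  "has_weak_rot \<Omega> V R \<longleftrightarrow> V \<in> L2_on \<Omega> \<and> R \<in> L2_on \<Omega> \<and>
     (\<forall>\<phi>\<in>test_functions \<Omega>. R \<bullet> L2_of \<phi> = V \<bullet> L2_of (curl \<phi>))"

text \<open>The trace \<open>\<gamma>(n \<cdot> V)\<close> of a field with \<open>div V\<close> in \<open>L\<^sub>2(\<Omega>)\<close> is the functional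
  \<open>\<gamma> h \<mapsto> (V, \<nabla>h) + (div V, h)\<close> on the traces of \<open>h \<in> H\<^sup>1(\<Omega>)\<close>; for fields smooth up to the
  boundary it is integration against the pointwise normal component (Green's formula).\<close>

definition normal_trace_zero :: "(real^3) set \<Rightarrow> (real^3) L2 \<Rightarrow> bool" where
  "normal_trace_zero \<Omega> V \<longleftrightarrow>
     (\<exists>D. has_weak_div \<Omega> V D \<and> (\<forall>H G. has_weak_grad \<Omega> H G \<longrightarrow> V \<bullet> G + D \<bullet> H = 0))"


section \<open>The subspaces and their eigenbases\<close>

definition gradient_fields :: "(real^3) set \<Rightarrow> (real^3) L2 set"  (\<open>\<A>\<close>) where
  "\<A> \<Omega> = {G. \<exists>H. has_weak_grad \<Omega> H G}"

definition V0 :: "(real^3) set \<Rightarrow> (real^3) L2 set" where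
  "V0 \<Omega> = L2_on \<Omega> \<inter> orthogonal_comp (\<A> \<Omega>)"

definition orthonormal_basis :: "('i \<Rightarrow> 'h::real_inner) \<Rightarrow> 'h set \<Rightarrow> bool" where
  "orthonormal_basis e M \<longleftrightarrow>
     (\<forall>i j. e i \<bullet> e j = (if i = j then 1 else 0)) \<and> closure (span (range e)) = M"

definition neg_grad_div_eigen :: "(real^3) set \<Rightarrow> real \<Rightarrow> (real^3) L2 \<Rightarrow> bool" where
  "neg_grad_div_eigen \<Omega> \<mu> V \<longleftrightarrow>
     (\<exists>D G. has_weak_div \<Omega> V D \<and> has_weak_grad \<Omega> D G \<and> - G = \<mu> *\<^sub>R V) \<and>
     normal_trace_zero \<Omega> V"

definition Sp_neg_grad_div :: "(real^3) set \<Rightarrow> real set" where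
  "Sp_neg_grad_div \<Omega> = {\<mu>. \<exists>V. V \<noteq> 0 \<and> neg_grad_div_eigen \<Omega> \<mu> V}"

definition grad_div_eigenbasis ::
    "(real^3) set \<Rightarrow> (nat \<Rightarrow> real) \<Rightarrow> (nat \<Rightarrow> (real^3) L2) \<Rightarrow> bool" where
  "grad_div_eigenbasis \<Omega> \<nu> q \<longleftrightarrow>
     orthonormal_basis q (\<A> \<Omega>) \<and>
     (\<forall>j. smooth_upto_boundary \<Omega> (q j) \<and> neg_grad_div_eigen \<Omega> ((\<nu> j)\<^sup>2) (q j)) \<and>
     0 < (\<nu> 0)\<^sup>2 \<and> mono (\<lambda>j. (\<nu> j)\<^sup>2)"

definition S_graph :: "(real^3) set \<Rightarrow> ((real^3) L2 \<times> (real^3) L2) set" where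
  "S_graph \<Omega> = {(F, R). F \<in> V0 \<Omega> \<and> R \<in> V0 \<Omega> \<and> has_weak_rot \<Omega> F R}"

definition rot_eigenbasis ::
    "(real^3) set \<Rightarrow> (nat \<Rightarrow> real) \<Rightarrow> (nat \<Rightarrow> (real^3) L2) \<Rightarrow> (nat \<Rightarrow> (real^3) L2) \<Rightarrow> bool" where
  "rot_eigenbasis \<Omega> lam qp qm \<longleftrightarrow>
     orthonormal_basis (case_sum qp qm) (V0 \<Omega>) \<and>
     (\<forall>j. (qp j, lam j *\<^sub>R qp j) \<in> S_graph \<Omega> \<and> normal_trace_zero \<Omega> (qp j)) \<and>
     (\<forall>j. (qm j, - lam j *\<^sub>R qm j) \<in> S_graph \<Omega> \<and> normal_trace_zero \<Omega> (qm j)) \<and>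
     0 < lam 0 \<and> mono lam"


section \<open>The classes \<open>C(2k, m)\<close> and the operator\<close>

text \<open>\<open>A\<^sup>s\<close>, used for even \<open>s\<close> only.\<close>

definition A_sp ::
    "(real^3) set \<Rightarrow> (nat \<Rightarrow> real) \<Rightarrow> (nat \<Rightarrow> (real^3) L2) \<Rightarrow> nat \<Rightarrow> (real^3) L2 set" where
  "A_sp \<Omega> \<nu> q s = {F \<in> \<A> \<Omega>. (\<lambda>j. \<nu> j ^ (2 * s) * (F \<bullet> q j)\<^sup>2) summable_on UNIV}"

definition A_normsq ::
    "(nat \<Rightarrow> real) \<Rightarrow> (nat \<Rightarrow> (real^3) L2) \<Rightarrow> nat \<Rightarrow> (real^3) L2 \<Rightarrow> real" where
  "A_normsq \<nu> q s F = (\<Sum>\<^sub>\<infinity>j. \<nu> j ^ (2 * s) * (F \<bullet> q j)\<^sup>2)"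

text \<open>An element of \<open>W\<^sup>m\<close> is the sequence of pairs \<open>w j = (f\<^sub>j\<^sup>+, f\<^sub>j\<^sup>-)\<close>.\<close>

definition W_sp :: "(nat \<Rightarrow> real) \<Rightarrow> int \<Rightarrow> (nat \<Rightarrow> real \<times> real) set" where
  "W_sp lam m = {w. (\<lambda>j. lam j powi (2 * m) * ((fst (w j))\<^sup>2 + (snd (w j))\<^sup>2)) summable_on UNIV}"

definition W_normsq :: "(nat \<Rightarrow> real) \<Rightarrow> int \<Rightarrow> (nat \<Rightarrow> real \<times> real) \<Rightarrow> real" where
  "W_normsq lam m w = (\<Sum>\<^sub>\<infinity>j. lam j powi (2 * m) * ((fst (w j))\<^sup>2 + (snd (w j))\<^sup>2))"

type_synonym C_elem = "(real^3) L2 \<times> (nat \<Rightarrow> real \<times> real)"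

definition C_class ::
    "(real^3) set \<Rightarrow> (nat \<Rightarrow> real) \<Rightarrow> (nat \<Rightarrow> (real^3) L2) \<Rightarrow> (nat \<Rightarrow> real) \<Rightarrow> nat \<Rightarrow> int \<Rightarrow> C_elem set"
  where "C_class \<Omega> \<nu> q lam s m = A_sp \<Omega> \<nu> q s \<times> W_sp lam m"

definition C_dist ::
    "(nat \<Rightarrow> real) \<Rightarrow> (nat \<Rightarrow> (real^3) L2) \<Rightarrow> (nat \<Rightarrow> real) \<Rightarrow> nat \<Rightarrow> int \<Rightarrow> C_elem \<Rightarrow> C_elem \<Rightarrow> real"
  where "C_dist \<nu> q lam s m f g =
    sqrt (A_normsq \<nu> q s (fst f - fst g) + W_normsq lam m (\<lambda>j. snd f j - snd g j))"

lemma l2_triangle: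
  fixes x y :: "nat \<Rightarrow> 'b::real_normed_vector"
  assumes x: "summable (\<lambda>j. (norm (x j))\<^sup>2)" and y: "summable (\<lambda>j. (norm (y j))\<^sup>2)"
  shows "summable (\<lambda>j. (norm (x j + y j))\<^sup>2)"
    and "sqrt (\<Sum>j. (norm (x j + y j))\<^sup>2) \<le> sqrt (\<Sum>j. (norm (x j))\<^sup>2) + sqrt (\<Sum>j. (norm (y j))\<^sup>2)"
proof -
  let ?B = "sqrt (\<Sum>j. (norm (x j))\<^sup>2) + sqrt (\<Sum>j. (norm (y j))\<^sup>2)"
  have B: "0 \<le> ?B" using x y by (simp add: suminf_nonneg)
  have le: "(\<Sum>j<n. (norm (x j + y j))\<^sup>2) \<le> ?B\<^sup>2" for n
  proof -
    have "sqrt (\<Sum>j<n. (norm (x j + y j))\<^sup>2) \<le> L2_set (\<lambda>j. norm (x j) + norm (y j)) {..<n}"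
      unfolding L2_set_def by (intro real_sqrt_le_mono sum_mono power_mono norm_triangle_ineq) auto
    also have "\<dots> \<le> L2_set (\<lambda>j. norm (x j)) {..<n} + L2_set (\<lambda>j. norm (y j)) {..<n}"
      by (rule L2_set_triangle_ineq)
    also have "\<dots> \<le> ?B"
      unfolding L2_set_def using x y by (intro add_mono real_sqrt_le_mono sum_le_suminf) auto
    finally show ?thesis by (rule sqrt_le_D)
  qed
  show s: "summable (\<lambda>j. (norm (x j + y j))\<^sup>2)"
    by (rule summableI_nonneg_bounded[OF _ le]) auto
  show "sqrt (\<Sum>j. (norm (x j + y j))\<^sup>2) \<le> ?B"
    using B by (intro real_le_lsqrt suminf_le_const[OF s le])
qed

lemma basis_coefficients_determine:
  assumes e: "orthonormal_basis e M" and FG: "F \<in> M" "G \<in> M"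
    and eq: "\<And>j. F \<bullet> e j = G \<bullet> e j"
  shows "F = G"
proof -
  have "closed {H. (F - G) \<bullet> H = 0}"
    by (intro closed_Collect_eq continuous_intros)
  moreover have "span (range e) \<subseteq> {H. (F - G) \<bullet> H = 0}"
    by (rule span_minimal) (auto simp: eq inner_diff_left subspace_def inner_add_right)
  ultimately have "closure (span (range e)) \<subseteq> {H. (F - G) \<bullet> H = 0}"
    by (simp add: closure_minimal)
  then have "(F - G) \<bullet> F = 0" "(F - G) \<bullet> G = 0"
    using e FG by (auto simp: orthonormal_basis_def)
  then have "(F - G) \<bullet> (F - G) = 0"
    by (simp only: inner_diff_right)
  then show ?thesis by simp
qed

lemma Metric_space_C:
  assumes q: "grad_div_eigenbasis \<Omega> \<nu> q" and l: "rot_eigenbasis \<Omega> lam qp qm"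
  shows "Metric_space (C_class \<Omega> \<nu> q lam s m) (C_dist \<nu> q lam s m)"
proof -
  define z :: "C_elem \<Rightarrow> nat \<Rightarrow> real \<times> real \<times> real" where
    "z f j = (\<nu> j ^ s * (fst f \<bullet> q j), lam j powi m * fst (snd f j), lam j powi m * snd (snd f j))" for f j
  let ?a = "\<lambda>f j. \<nu> j ^ (2 * s) * (fst f \<bullet> q j)\<^sup>2"
  let ?w = "\<lambda>f j. lam j powi (2 * m) * ((fst (snd f j))\<^sup>2 + (snd (snd f j))\<^sup>2)"
  have nz: "(norm (z f j))\<^sup>2 = ?a f j + ?w f j" for f j
  proof -
    have "(norm (z f j))\<^sup>2 = (\<nu> j ^ s)\<^sup>2 * (fst f \<bullet> q j)\<^sup>2 +
        (lam j powi m)\<^sup>2 * ((fst (snd f j))\<^sup>2 + (snd (snd f j))\<^sup>2)"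
      by (simp only: z_def power2_norm_eq_inner inner_Pair inner_real_def)
        (simp add: power2_eq_square algebra_simps)
    moreover have "(\<nu> j ^ s)\<^sup>2 = \<nu> j ^ (2 * s)"
      by (simp add: power_even_eq)
    moreover have "(lam j powi m)\<^sup>2 = lam j powi (2 * m)"
      by (simp add: mult.commute[of 2 m] power_int_mult)
    ultimately show ?thesis by simp
  qed
  have lpos: "0 < lam j" for j
    using l monoD[of lam 0 j] by (auto simp: rot_eigenbasis_def)
  have npos: "\<nu> j \<noteq> 0" for j
    using q monoD[of "\<lambda>j. (\<nu> j)\<^sup>2" 0 j] by (auto simp: grad_div_eigenbasis_def)
  have a0: "0 \<le> ?a f j" for f :: C_elem and j
    by (simp add: power_mult)
  have w0: "0 \<le> ?w f j" for f :: C_elem and j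
    using lpos[of j] by (auto intro!: mult_nonneg_nonneg)
  have sm: "summable (\<lambda>j. (norm (z f j))\<^sup>2)" if "f \<in> C_class \<Omega> \<nu> q lam s m" for f
    unfolding nz using that
    by (intro summable_add summable_on_imp_summable) (auto simp: C_class_def A_sp_def W_sp_def)
  define mi where "mi f g = (fst f - fst g, \<lambda>j. snd f j - snd g j)" for f g :: C_elem
  have zmi: "z (mi f g) j = z f j - z g j" for f g j
    by (simp add: z_def mi_def inner_diff_left algebra_simps)
  have smi: "summable (\<lambda>j. (norm (z f j - z g j))\<^sup>2)"
    if "f \<in> C_class \<Omega> \<nu> q lam s m" "g \<in> C_class \<Omega> \<nu> q lam s m" for f g
    using l2_triangle(1)[of "z f" "\<lambda>j. - z g j"] sm[OF that(1)] sm[OF that(2)] by simp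
  have sa: "summable (?a (mi f g))" and sw: "summable (?w (mi f g))"
    if "f \<in> C_class \<Omega> \<nu> q lam s m" "g \<in> C_class \<Omega> \<nu> q lam s m" for f g
    using smi[OF that] a0 w0
    by (auto simp: nz zmi[symmetric] intro!: summable_comparison_test'[of "\<lambda>j. ?a (mi f g) j + ?w (mi f g) j" 0])
  have d: "C_dist \<nu> q lam s m f g = sqrt (\<Sum>j. (norm (z f j - z g j))\<^sup>2)"
    if "f \<in> C_class \<Omega> \<nu> q lam s m" "g \<in> C_class \<Omega> \<nu> q lam s m" for f g
  proof -
    have "infsum (?a (mi f g)) UNIV = suminf (?a (mi f g))"
      using sa[OF that] a0 by (intro infsumI norm_summable_imp_has_sum summable_sums) auto
    moreover have "infsum (?w (mi f g)) UNIV = suminf (?w (mi f g))"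
      using sw[OF that] w0 by (intro infsumI norm_summable_imp_has_sum summable_sums) auto
    moreover have "(\<Sum>j. (norm (z f j - z g j))\<^sup>2) = suminf (?a (mi f g)) + suminf (?w (mi f g))"
      using suminf_add[OF sa[OF that] sw[OF that]] by (simp add: nz zmi[symmetric])
    ultimately show ?thesis
      by (simp add: C_dist_def A_normsq_def W_normsq_def mi_def)
  qed
  show ?thesis
  proof
    fix f g h
    show "0 \<le> C_dist \<nu> q lam s m f g"
      unfolding C_dist_def A_normsq_def W_normsq_def using a0[of _ "mi f g"] w0[of _ "mi f g"]
      by (intro real_sqrt_ge_zero add_nonneg_nonneg infsum_nonneg) (auto simp: mi_def)
    show "C_dist \<nu> q lam s m f g = C_dist \<nu> q lam s m g f"
      by (simp add: C_dist_def A_normsq_def W_normsq_def inner_diff_left power2_commute)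
    assume f: "f \<in> C_class \<Omega> \<nu> q lam s m" and g: "g \<in> C_class \<Omega> \<nu> q lam s m"
    show "(C_dist \<nu> q lam s m f g = 0) = (f = g)"
    proof
      assume "C_dist \<nu> q lam s m f g = 0"
      then have "\<forall>j. (norm (z f j - z g j))\<^sup>2 = 0"
        by (simp add: d[OF f g] suminf_eq_zero_iff[OF smi[OF f g]])
      then have zz: "z f j = z g j" for j by simp
      then have "fst f \<bullet> q j = fst g \<bullet> q j" for j
        using npos[of j] zz[of j] by (simp add: z_def)
      then have "fst f = fst g"
        using basis_coefficients_determine[of q "\<A> \<Omega>" "fst f" "fst g"] f g q
        by (auto simp: grad_div_eigenbasis_def C_class_def A_sp_def)
      moreover have "snd f j = snd g j" for j
        using zz[of j] lpos[of j] by (auto simp: z_def prod_eq_iff)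
      ultimately show "f = g" by (auto simp: prod_eq_iff)
    next
      assume "f = g" then show "C_dist \<nu> q lam s m f g = 0"
        using d[OF g g] by simp
    qed
    assume h: "h \<in> C_class \<Omega> \<nu> q lam s m"
    show "C_dist \<nu> q lam s m f h \<le> C_dist \<nu> q lam s m f g + C_dist \<nu> q lam s m g h"
      using l2_triangle(2)[OF smi[OF f g] smi[OF g h]] by (simp add: d f g h)
  qed
qed

definition C_topology ::
    "(real^3) set \<Rightarrow> (nat \<Rightarrow> real) \<Rightarrow> (nat \<Rightarrow> (real^3) L2) \<Rightarrow> (nat \<Rightarrow> real) \<Rightarrow> nat \<Rightarrow> int \<Rightarrow> C_elem topology"
  where "C_topology \<Omega> \<nu> q lam s m =
    Metric_space.mtopology (C_class \<Omega> \<nu> q lam s m) (C_dist \<nu> q lam s m)"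

definition N_d :: "(nat \<Rightarrow> real) \<Rightarrow> (nat \<Rightarrow> (real^3) L2) \<Rightarrow> (real^3) L2 \<Rightarrow> (real^3) L2" where
  "N_d \<nu> q F = - (\<Sum>j. ((\<nu> j)\<^sup>2 * (F \<bullet> q j)) *\<^sub>R q j)"

text \<open>\<open>\<nabla>div + c I\<close> on \<open>A \<oplus> W\<close>: \<open>\<nabla>div\<close> annihilates the second component.\<close>

definition grad_div_plus ::
    "(nat \<Rightarrow> real) \<Rightarrow> (nat \<Rightarrow> (real^3) L2) \<Rightarrow> real \<Rightarrow> C_elem \<Rightarrow> C_elem" where
  "grad_div_plus \<nu> q c f = (N_d \<nu> q (fst f) + c *\<^sub>R fst f, \<lambda>j. c *\<^sub>R snd f j)"

end

(* On coefficients the operator multiplies (f, q_j) by nu^2 - nu_j^2 and scales the second component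
   by nu^2.  Each nu_j^2 is an eigenvalue by hypothesis, and so is 0: every q_j^+ is a divergence free
   field with zero normal trace.  Hence no multiplier vanishes.  Two-sided bounds of |nu^2 - nu_j^2|
   by multiples of nu_j^2, with Riesz-Fischer in the complete space L_2, then give the claim.

   The lower bound needs nu_j -> infinity.  Rellich's theorem is avoided: if nu_j^2 <= L for all j,
   then the fields div q_j are orthogonal with squared norms nu_j^2 <= L, and Bessel's inequality
   yields |grad h|^2 <= L |h|^2 for all h in H^1.  This contradicts Poincare's inequality for a bump
   function with small support. *)
theory Submission
  imports Defs
begin

section \<open>Completeness of the space of square integrable functions\<close>

text \<open>\<open>neg_grad_div_eigen\<close> asks for a weak divergence twice: one field has the
  prescribed gradient, another enters the trace identity, and nothing in the definition identifies
  them. Orthogonality of the divergences needs one field \<open>D j\<close> with both properties: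
  the trace identity of \<open>q i\<close>, applied to the potential \<open>D j\<close> with
  gradient -nu_j^2 \<open>q j\<close>, then reads (\<open>D i\<close>, \<open>D j\<close>) = nu_j^2
  (\<open>q i\<close>, \<open>q j\<close>). Instead of showing that the two divergences coincide,
  the proof moves the gradient from one to the other by difference quotients of test functions.

  Unboundedness matters because being different from every nu_j^2 does not keep nu^2 away from them:
  bounded eigenvalues could accumulate at nu^2, and division by the multipliers would be unbounded.
  Once nu_j^2 grows, monotonicity leaves only finitely many j without the bound nu_j^2 <= 2 |nu^2 -
  nu_j^2|.

  Completeness serves two series in the \<open>q j\<close>: the one that defines \<open>N_d\<close>
  and the one that builds a preimage.\<close>

lemma sq_integrable_diff:
  assumes "sq_integrable f" "sq_integrable g"
  shows "sq_integrable (\<lambda>x. f x - g x)"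
  using sq_integrable_add[OF assms(1) sq_integrable_scaleR[OF assms(2), of "-1"]] by simp

lemma L2_of_cases: obtains f where "sq_integrable f" "F = L2_of f"
proof -
  have "\<exists>f. sq_integrable f \<and> F = L2_of f"
    by (induction F rule: L2.abs_induct) (auto simp: L2_rel_def L2_of_def)
  then show ?thesis using that by blast
qed

lemma inner_L2_of:
  assumes "sq_integrable f" "sq_integrable g"
  shows "L2_of f \<bullet> L2_of g = (\<integral>x. f x \<bullet> g x \<partial>lebesgue)"
  using assms by (simp add: L2_of_def inner_L2.abs_eq L2_rel_def)

lemma L2_of_add:
  assumes "sq_integrable f" "sq_integrable g"
  shows "L2_of (\<lambda>x. f x + g x) = L2_of f + L2_of g"
  using assms sq_integrable_add[OF assms] by (simp add: L2_of_def plus_L2.abs_eq L2_rel_def)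

lemma L2_of_scaleR:
  assumes "sq_integrable f"
  shows "L2_of (\<lambda>x. c *\<^sub>R f x) = c *\<^sub>R L2_of f"
  using assms sq_integrable_scaleR[OF assms] by (simp add: L2_of_def scaleR_L2.abs_eq L2_rel_def)

lemma L2_of_diff:
  assumes "sq_integrable f" "sq_integrable g"
  shows "L2_of (\<lambda>x. f x - g x) = L2_of f - L2_of g"
  using L2_of_add[OF assms(1) sq_integrable_scaleR[OF assms(2), of "-1"]]
    L2_of_scaleR[OF assms(2), of "-1"] by simp

lemma norm_L2_of:
  assumes "sq_integrable f"
  shows "(norm (L2_of f))\<^sup>2 = (\<integral>x. (norm (f x))\<^sup>2 \<partial>lebesgue)"
  using assms by (simp add: power2_norm_eq_inner inner_L2_of)

lemma sq_integrable_norm: "sq_integrable f \<Longrightarrow> sq_integrable (\<lambda>x. norm (f x))"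
  by (auto simp: sq_integrable_def)

lemma norm_L2_of_norm:
  assumes "sq_integrable f"
  shows "norm (L2_of (\<lambda>x. norm (f x))) = norm (L2_of f)"
proof (rule power2_eq_imp_eq)
  show "(norm (L2_of (\<lambda>x. norm (f x))))\<^sup>2 = (norm (L2_of f))\<^sup>2"
    using assms by (subst (1 2) norm_L2_of) (simp_all add: sq_integrable_norm)
qed auto

lemma nn_integral_L2_of:
  assumes "sq_integrable f"
  shows "(\<integral>\<^sup>+x. ennreal ((norm (f x))\<^sup>2) \<partial>lebesgue) = ennreal ((norm (L2_of f))\<^sup>2)"
  using assms by (simp add: norm_L2_of nn_integral_eq_integral sq_integrable_def)

text \<open>Lebesgue measure on the whole space is infinite, so square integrable functions need not
  be integrable; a weight repairs this. Sigma-finiteness supplies a positive integrable weight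
  bounded by 1, and then \<open>(w x)\<^sup>2 \<le> w x\<close>.\<close>

lemma positive_sq_integrable:
  obtains w :: "real^3 \<Rightarrow> real" where "sq_integrable w" "\<And>x. w x > 0"
proof -
  obtain w :: "real^3 \<Rightarrow> real" where w: "w \<in> borel_measurable lborel" "\<And>x. w x > 0"
    "\<And>x. w x \<le> 1" "integrable lborel w"
    using sigma_finite_measure.obtain_positive_integrable_function[OF sigma_finite_lborel] by blast
  have "(w x)\<^sup>2 \<le> w x" for x
    using w(2,3)[of x] by (simp add: power2_eq_square mult_left_le)
  then have "integrable lborel (\<lambda>x. (w x)\<^sup>2)"
    using w by (intro Bochner_Integration.integrable_bound[OF w(4)]) (auto simp: abs_of_pos)
  then have "sq_integrable w"
    using w by (simp add: sq_integrable_def integrable_completion measurable_completion)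
  with that w(2) show ?thesis by blast
qed

text \<open>Multiplication by a positive square integrable weight turns a Cauchy sequence of \<open>L\<^sub>2\<close> into one
  of \<open>L\<^sub>1\<close>, which has an almost everywhere convergent subsequence.\<close>

instance L2 :: (euclidean_space) banach
proof
  fix X :: "nat \<Rightarrow> 'a L2"
  assume X: "Cauchy X"
  have CX: "\<exists>N. \<forall>i\<ge>N. \<forall>j\<ge>N. norm (X i - X j) < e" if "e > 0" for e
    using X that by (auto simp: Cauchy_def dist_norm)
  have "\<forall>n. \<exists>f. sq_integrable f \<and> X n = L2_of f"
    using L2_of_cases by metis
  then obtain f where f: "\<And>n. sq_integrable (f n)" "\<And>n. X n = L2_of (f n)"
    by metis
  have fm[measurable]: "f n \<in> borel_measurable lebesgue" for n
    using f by (simp add: sq_integrable_def)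
  obtain w :: "real^3 \<Rightarrow> real" where w: "sq_integrable w" "\<And>x. w x > 0"
    using positive_sq_integrable by blast
  have wm[measurable]: "w \<in> borel_measurable lebesgue"
    using w by (simp add: sq_integrable_def)
  \<comment> \<open>The product of two reals is written as an inner product so that
    \<open>sq_integrable_inner\<close> and \<open>inner_L2_of\<close> apply to it.\<close>
  have nw: "norm (w x *\<^sub>R v) = w x \<bullet> norm v" for x and v :: 'a
    using w(2)[of x] by simp
  have "integrable lebesgue (\<lambda>x. w x \<bullet> norm (f n x))" for n
    by (rule sq_integrable_inner[OF w(1) sq_integrable_norm[OF f(1)]])
  then have int: "integrable lebesgue (\<lambda>x. w x *\<^sub>R f n x)" for n
    by (subst integrable_norm_iff[symmetric]) (simp_all only: nw, measurable)
  have L1: "(LINT x|lebesgue. norm (w x *\<^sub>R f i x - w x *\<^sub>R f j x)) \<le> norm (L2_of w) * norm (X i - X j)" for i j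
  proof -
    let ?d = "\<lambda>x. f i x - f j x"
    have d: "sq_integrable ?d" using f by (simp add: sq_integrable_diff)
    have "(LINT x|lebesgue. norm (w x *\<^sub>R f i x - w x *\<^sub>R f j x)) = L2_of w \<bullet> L2_of (\<lambda>x. norm (?d x))"
      by (subst inner_L2_of[OF w(1) sq_integrable_norm[OF d]])
        (simp only: nw scaleR_diff_right[symmetric])
    also have "\<dots> \<le> norm (L2_of w) * norm (L2_of (\<lambda>x. norm (?d x)))"
      by (rule norm_cauchy_schwarz)
    also have "norm (L2_of (\<lambda>x. norm (?d x))) = norm (L2_of ?d)"
      by (rule norm_L2_of_norm[OF d])
    also have "L2_of ?d = X i - X j" using f by (simp add: L2_of_diff)
    finally show ?thesis .
  qed
  have cau: "\<exists>N. \<forall>i\<ge>N. \<forall>j\<ge>N. (LINT x|lebesgue. norm (w x *\<^sub>R f i x - w x *\<^sub>R f j x)) < e" if "e > 0" for e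
  proof -
    have p: "e / (norm (L2_of w) + 1) > 0" using that by (simp add: add_nonneg_pos)
    obtain N where N: "\<And>i j. i \<ge> N \<Longrightarrow> j \<ge> N \<Longrightarrow> norm (X i - X j) < e / (norm (L2_of w) + 1)"
      using CX[OF p] by blast
    have "norm (L2_of w) * norm (X i - X j) < e" if "i \<ge> N" "j \<ge> N" for i j
    proof -
      have "norm (L2_of w) * norm (X i - X j) \<le> (norm (L2_of w) + 1) * norm (X i - X j)"
        by (simp add: mult_right_mono)
      also have "\<dots> < e"
        using N[OF that] by (simp add: pos_less_divide_eq add_nonneg_pos mult.commute)
      finally show ?thesis .
    qed
    with L1 show ?thesis by (meson order_le_less_trans)
  qed
  obtain r where r: "strict_mono r" "AE x in lebesgue. Cauchy (\<lambda>i. w x *\<^sub>R f (r i) x)"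
    by (rule cauchy_L1_AE_cauchy_subseq[OF int], erule cau, blast)
  \<comment> \<open>Where the subsequence diverges the value of \<open>lim\<close> is arbitrary;
    this happens only on a null set.\<close>
  define F where "F x = lim (\<lambda>i. f (r i) x)" for x
  have Fm[measurable]: "F \<in> borel_measurable lebesgue"
    unfolding F_def by measurable
  have lim: "AE x in lebesgue. (\<lambda>i. f (r i) x) \<longlonglongrightarrow> F x"
    using r(2)
  proof (rule AE_mp, intro AE_I2 impI)
    fix x assume "Cauchy (\<lambda>i. w x *\<^sub>R f (r i) x)"
    then have "convergent (\<lambda>i. w x *\<^sub>R f (r i) x)"
      by (rule Cauchy_convergent)
    then have "convergent (\<lambda>i. inverse (w x) *\<^sub>R w x *\<^sub>R f (r i) x)"
      unfolding convergent_def using tendsto_scaleR[OF tendsto_const] by blast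
    then show "(\<lambda>i. f (r i) x) \<longlonglongrightarrow> F x"
      using w(2)[of x] by (simp add: F_def convergent_LIMSEQ_iff)
  qed
  \<comment> \<open>Fatou's lemma along the subsequence delivers integrability and the norm bound
    from one estimate, without a majorant.\<close>
  have fatou: "sq_integrable (\<lambda>x. F x - f n x) \<and> norm (L2_of (\<lambda>x. F x - f n x)) \<le> e"
    if e: "e > 0" and N: "\<And>i. i \<ge> N \<Longrightarrow> norm (X i - X n) < e" for e N n
  proof -
    have "(\<integral>\<^sup>+x. ennreal ((norm (F x - f n x))\<^sup>2) \<partial>lebesgue) =
      (\<integral>\<^sup>+x. liminf (\<lambda>i. ennreal ((norm (f (r i) x - f n x))\<^sup>2)) \<partial>lebesgue)"
    proof (rule nn_integral_cong_AE, use lim in \<open>rule AE_mp\<close>, intro AE_I2 impI)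
      fix x assume "(\<lambda>i. f (r i) x) \<longlonglongrightarrow> F x"
      then have "(\<lambda>i. ennreal ((norm (f (r i) x - f n x))\<^sup>2)) \<longlonglongrightarrow> ennreal ((norm (F x - f n x))\<^sup>2)"
        by (intro tendsto_intros)
      then show "ennreal ((norm (F x - f n x))\<^sup>2) = liminf (\<lambda>i. ennreal ((norm (f (r i) x - f n x))\<^sup>2))"
        by (intro lim_imp_Liminf[symmetric]) auto
    qed
    also have "\<dots> \<le> liminf (\<lambda>i. \<integral>\<^sup>+x. ennreal ((norm (f (r i) x - f n x))\<^sup>2) \<partial>lebesgue)"
      using sq_integrable_diff[OF f(1) f(1)] by (intro nn_integral_liminf) (auto simp: sq_integrable_def)
    also have "\<dots> = liminf (\<lambda>i. ennreal ((norm (X (r i) - X n))\<^sup>2))"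
      using f by (subst nn_integral_L2_of) (simp_all add: sq_integrable_diff L2_of_diff)
    also have "\<dots> \<le> ennreal (e\<^sup>2)"
    proof (rule Liminf_le)
      have "eventually (\<lambda>i. ennreal ((norm (X (r i) - X n))\<^sup>2) \<le> ennreal (e\<^sup>2)) sequentially"
        using eventually_ge_at_top[of N]
      proof eventually_elim
        case (elim i)
        then have "norm (X (r i) - X n) \<le> e"
          using N[of "r i"] seq_suble[OF r(1), of i] by simp
        then show ?case by (intro ennreal_leI power_mono) auto
      qed
      then show "\<forall>\<^sub>F i in sequentially. ennreal ((norm (X (r i) - X n))\<^sup>2) \<le> ennreal (e\<^sup>2)" .
    qed simp
    finally have le: "(\<integral>\<^sup>+x. ennreal ((norm (F x - f n x))\<^sup>2) \<partial>lebesgue) \<le> ennreal (e\<^sup>2)" .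
    then have "integrable lebesgue (\<lambda>x. (norm (F x - f n x))\<^sup>2)"
      by (intro integrableI_bounded) (auto simp: le_less_trans)
    then have s: "sq_integrable (\<lambda>x. F x - f n x)"
      by (simp add: sq_integrable_def)
    then have "(norm (L2_of (\<lambda>x. F x - f n x)))\<^sup>2 \<le> e\<^sup>2"
      using le by (simp add: nn_integral_L2_of)
    then show ?thesis using s e by (simp add: power2_le_iff_abs_le)
  qed
  \<comment> \<open>So far only differences with \<open>F\<close> are controlled; \<open>F\<close>
    itself is recovered as (\<open>F\<close> - \<open>f N0\<close>) + \<open>f N0\<close>.\<close>
  obtain N0 where "\<And>i j. i \<ge> N0 \<Longrightarrow> j \<ge> N0 \<Longrightarrow> norm (X i - X j) < 1"
    using CX[OF zero_less_one] by blast
  then have "sq_integrable (\<lambda>x. F x - f N0 x)"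
    using fatou[of 1 N0 N0] by auto
  from sq_integrable_add[OF this f(1)[of N0]] have F: "sq_integrable F"
    by simp
  have "X \<longlonglongrightarrow> L2_of F"
  proof (rule LIMSEQ_I)
    fix e :: real assume "e > 0"
    then have e2: "e / 2 > 0" by simp
    obtain N where N: "\<And>i j. i \<ge> N \<Longrightarrow> j \<ge> N \<Longrightarrow> norm (X i - X j) < e / 2"
      using CX[OF e2] by blast
    have "norm (X n - L2_of F) < e" if "n \<ge> N" for n
    proof -
      have "norm (L2_of F - X n) \<le> e / 2"
        using fatou[of "e / 2" N n] N that e2 f F by (auto simp: L2_of_diff)
      then show ?thesis using \<open>e > 0\<close> by (simp add: norm_minus_commute)
    qed
    then show "\<exists>N. \<forall>n\<ge>N. norm (X n - L2_of F) < e" by blast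
  qed
  then show "convergent X" by (rule convergentI)
qed

section \<open>Integration by parts for test functions\<close>

lemma Ck_on_1_D:
  assumes "Ck_on 1 UNIV f"
  shows "(f has_derivative frechet_derivative f (at x)) (at x)" "continuous_on UNIV (pd i f)"
    "continuous_on UNIV f"
proof -
  have d: "f differentiable at x" for x
    using assms by simp
  then show "(f has_derivative frechet_derivative f (at x)) (at x)"
    by (simp add: frechet_derivative_works)
  show "continuous_on UNIV (pd i f)"
    using assms by simp
  show "continuous_on UNIV f"
    using d by (simp add: continuous_at_imp_continuous_on differentiable_imp_continuous_within)
qed

lemma pd_eqI: "(f has_derivative f') (at x) \<Longrightarrow> pd i f x = f' (axis i 1)"
  unfolding pd_def using frechet_derivative_at by metis

lemma Ck_on_1_I:
  assumes "\<And>x. (f has_derivative f' x) (at x)" "\<And>i. continuous_on UNIV (\<lambda>x. f' x (axis i 1))"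
  shows "Ck_on 1 UNIV f"
proof -
  have "pd i f = (\<lambda>x. f' x (axis i 1))" for i
    using pd_eqI[OF assms(1)] by auto
  then show ?thesis
    using assms by (auto simp: differentiable_def)
qed

lemma has_vector_derivative_along_axis:
  fixes f :: "real^3 \<Rightarrow> 'a::real_normed_vector"
  assumes "Ck_on 1 UNIV f"
  shows "((\<lambda>t. f (x + t *\<^sub>R axis i 1)) has_vector_derivative pd i f (x + t *\<^sub>R axis i 1)) (at t)"
proof -
  let ?D = "frechet_derivative f (at (x + t *\<^sub>R axis i 1))"
  have f: "(f has_derivative ?D) (at (x + t *\<^sub>R axis i 1))"
    using assms by (rule Ck_on_1_D)
  have "((\<lambda>t. x + t *\<^sub>R axis i 1) has_derivative (\<lambda>h. h *\<^sub>R axis i 1)) (at t)"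
    by (auto intro!: derivative_eq_intros)
  from diff_chain_at[OF this f]
  have "((\<lambda>t. f (x + t *\<^sub>R axis i 1)) has_derivative (\<lambda>h. ?D (h *\<^sub>R axis i 1))) (at t)"
    by (simp add: o_def)
  then show ?thesis
    using linear_scale[OF has_derivative_linear[OF f]]
    by (simp add: has_vector_derivative_def pd_def)
qed

definition diff_quot :: "3 \<Rightarrow> real \<Rightarrow> (real^3 \<Rightarrow> real) \<Rightarrow> real^3 \<Rightarrow> real" where
  "diff_quot i h f x = (f (x + h *\<^sub>R axis i 1) - f x) / h"

lemma diff_quot_tendsto_pd:
  assumes "Ck_on 1 UNIV f"
  shows "((\<lambda>h. diff_quot i h f x) \<longlongrightarrow> pd i f x) (at 0)"
proof -
  have "((\<lambda>t. f (x + t *\<^sub>R axis i 1)) has_real_derivative pd i f x) (at 0)"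
    using has_vector_derivative_along_axis[OF assms, of x i 0]
    by (simp add: has_real_derivative_iff_has_vector_derivative)
  then show ?thesis
    by (simp add: DERIV_def diff_quot_def)
qed

lemma abs_diff_quot_le:
  assumes f: "Ck_on 1 UNIV f" and M: "\<And>y. \<bar>pd i f y\<bar> \<le> M" and "h \<noteq> 0"
  shows "\<bar>diff_quot i h f x\<bar> \<le> M"
proof -
  let ?g = "\<lambda>t. f (x + t *\<^sub>R axis i 1)"
  have g: "(?g has_real_derivative pd i f (x + t *\<^sub>R axis i 1)) (at t)" for t
    using has_vector_derivative_along_axis[OF f, of x i t]
    by (simp add: has_real_derivative_iff_has_vector_derivative)
  have "norm (?g h - ?g 0) \<le> M * norm (h - 0)"
    by (rule field_differentiable_bound[where S = UNIV, OF _ g[THEN has_field_derivative_at_within]])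
      (use M in auto)
  then show ?thesis
    using \<open>h \<noteq> 0\<close> by (simp add: diff_quot_def divide_simps mult.commute)
qed

lemma test_functions_outside:
  assumes "\<phi> \<in> test_functions \<Omega>" "x \<notin> closure {x. \<phi> x \<noteq> 0}"
  shows "\<phi> x = 0" "pd i \<phi> x = 0"
proof -
  let ?U = "- closure {x. \<phi> x \<noteq> 0}"
  have U: "open ?U" "x \<in> ?U" using assms by auto
  have z: "\<phi> y = 0" if "y \<in> ?U" for y
    using that closure_subset[of "{x. \<phi> x \<noteq> 0}"] by auto
  then show "\<phi> x = 0" using U(2) .
  have "(\<phi> has_derivative (\<lambda>_. 0)) (at x)"
    by (rule has_derivative_transform_within_open[OF has_derivative_const[of 0] U]) (rule z[symmetric])
  then show "pd i \<phi> x = 0"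
    by (simp add: pd_eqI)
qed

lemma test_functions_bounded:
  assumes "\<phi> \<in> test_functions \<Omega>"
  obtains R where "\<And>x. norm x > R \<Longrightarrow> \<phi> x = 0" "\<And>x i. norm x > R \<Longrightarrow> pd i \<phi> x = 0"
proof -
  have "bounded (closure {x. \<phi> x \<noteq> 0})"
    using assms by (simp add: test_functions_def compact_imp_bounded)
  then obtain R where "\<And>x. x \<in> closure {x. \<phi> x \<noteq> 0} \<Longrightarrow> norm x \<le> R"
    by (auto simp: bounded_iff)
  with that test_functions_outside[OF assms] show ?thesis
    by (metis not_less)
qed

lemma sq_integrable_continuous:
  fixes f :: "real^3 \<Rightarrow> 'a::euclidean_space"
  assumes f: "continuous_on UNIV f" and R: "\<And>x. norm x > R \<Longrightarrow> f x = 0"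
  shows "sq_integrable f"
proof -
  have "integrable lborel (\<lambda>x. indicator (cball 0 R) x *\<^sub>R (norm (f x))\<^sup>2)"
    by (intro borel_integrable_compact continuous_intros continuous_on_subset[OF f]) auto
  also have "(\<lambda>x. indicator (cball 0 R) x *\<^sub>R (norm (f x))\<^sup>2) = (\<lambda>x. (norm (f x))\<^sup>2)"
    using R by (auto simp: fun_eq_iff indicator_def not_le)
  finally have "integrable lebesgue (\<lambda>x. (norm (f x))\<^sup>2)"
    using integrable_completion[of "\<lambda>x. (norm (f x))\<^sup>2" lborel] by auto
  moreover have "f \<in> borel_measurable lebesgue"
    using borel_measurable_continuous_onI[OF f] by (simp add: measurable_completion)
  ultimately show ?thesis by (simp add: sq_integrable_def)
qed

lemma test_functions_sq_integrable:
  assumes "\<phi> \<in> test_functions \<Omega>"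
  shows "sq_integrable \<phi>" "sq_integrable (pd i \<phi>)"
proof -
  obtain R where R: "\<And>x. norm x > R \<Longrightarrow> \<phi> x = 0" "\<And>x i. norm x > R \<Longrightarrow> pd i \<phi> x = 0"
    using test_functions_bounded[OF assms] by blast
  have C: "Ck_on 1 UNIV \<phi>"
    using assms by (simp add: test_functions_def)
  show "sq_integrable \<phi>" "sq_integrable (pd i \<phi>)"
    using sq_integrable_continuous[OF Ck_on_1_D(3)[OF C] R(1)]
      sq_integrable_continuous[OF Ck_on_1_D(2)[OF C] R(2)] by auto
qed

text \<open>For a merely C^1 function, \<open>pd i \<phi>\<close> is continuous but in general not a
  test function; the quotients replace it. The compact support has a positive distance from the
  complement of the open set, and shifts shorter than that stay inside.\<close>

lemma diff_quot_test_function: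
  assumes "\<phi> \<in> test_functions \<Omega>" and "open \<Omega>"
  shows "\<forall>\<^sub>F h in at 0. diff_quot i h \<phi> \<in> test_functions \<Omega>"
proof -
  let ?K = "closure {x. \<phi> x \<noteq> 0}"
  have C: "Ck_on 1 UNIV \<phi>" and K: "compact ?K" "?K \<subseteq> \<Omega>"
    using assms by (auto simp: test_functions_def)
  obtain \<epsilon> where \<epsilon>: "\<epsilon> > 0" "(\<Union>x\<in>?K. cball x \<epsilon>) \<subseteq> \<Omega>"
    using compact_subset_open_imp_cball_epsilon_subset[OF K(1) \<open>open \<Omega>\<close> K(2)] by blast
  have "diff_quot i h \<phi> \<in> test_functions \<Omega>" if h: "h \<noteq> 0" "\<bar>h\<bar> < \<epsilon>" for h
  proof -
    let ?L = "?K \<union> (\<lambda>x. x - h *\<^sub>R axis i 1) ` ?K"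
    have "Ck_on 1 UNIV (diff_quot i h \<phi>)"
    proof (rule Ck_on_1_I)
      let ?D = "\<lambda>x. frechet_derivative \<phi> (at x)"
      show "(diff_quot i h \<phi> has_derivative (\<lambda>v. (?D (x + h *\<^sub>R axis i 1) v - ?D x v) / h)) (at x)" for x
      proof -
        have "((\<lambda>x. x + h *\<^sub>R axis i 1) has_derivative (\<lambda>v. v)) (at x)"
          by (auto intro!: derivative_eq_intros)
        from diff_chain_at[OF this Ck_on_1_D(1)[OF C]]
        have "((\<lambda>x. \<phi> (x + h *\<^sub>R axis i 1)) has_derivative ?D (x + h *\<^sub>R axis i 1)) (at x)"
          by (simp add: o_def)
        then have "((\<lambda>x. (\<phi> (x + h *\<^sub>R axis i 1) - \<phi> x) / h) has_derivative
            (\<lambda>v. (?D (x + h *\<^sub>R axis i 1) v - ?D x v) / h)) (at x)"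
          using Ck_on_1_D(1)[OF C] h by (auto intro!: derivative_eq_intros simp: divide_simps)
        then show ?thesis by (simp add: diff_quot_def[abs_def])
      qed
      have "continuous_on UNIV (\<lambda>x. (pd j \<phi> (x + h *\<^sub>R axis i 1) - pd j \<phi> x) / h)" for j
        using h by (intro continuous_intros continuous_on_compose2[OF Ck_on_1_D(2)[OF C]]) auto
      then show "continuous_on UNIV (\<lambda>x. (?D (x + h *\<^sub>R axis i 1) (axis j 1) - ?D x (axis j 1)) / h)" for j
        by (simp add: pd_def)
    qed
    moreover have L: "compact ?L"
      using K(1) by (intro compact_Un compact_continuous_image continuous_intros)
    moreover have sub: "closure {x. diff_quot i h \<phi> x \<noteq> 0} \<subseteq> ?L"
    proof (rule closure_minimal)
      show "{x. diff_quot i h \<phi> x \<noteq> 0} \<subseteq> ?L"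
      proof
        fix x assume "x \<in> {x. diff_quot i h \<phi> x \<noteq> 0}"
        then have "\<phi> (x + h *\<^sub>R axis i 1) \<noteq> 0 \<or> \<phi> x \<noteq> 0"
          by (auto simp: diff_quot_def)
        then have "x + h *\<^sub>R axis i 1 \<in> ?K \<or> x \<in> ?K"
          using closure_subset[of "{x. \<phi> x \<noteq> 0}"] by blast
        then show "x \<in> ?L" by (force simp: image_iff)
      qed
    qed (use L compact_imp_closed in blast)
    moreover have "?L \<subseteq> \<Omega>"
    proof -
      have "x - h *\<^sub>R axis i 1 \<in> cball x \<epsilon>" for x :: "real^3"
        using h unfolding mem_cball dist_norm by (simp add: norm_axis_1)
      then show ?thesis using \<epsilon> K(2) by blast
    qed
    moreover have "compact (closure {x. diff_quot i h \<phi> x \<noteq> 0})"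
      using L sub by (meson closed_closure compact_Int_closed compact_closure compact_imp_bounded bounded_subset closure_subset)
    ultimately show ?thesis
      unfolding test_functions_def by blast
  qed
  then show ?thesis
    using \<epsilon>(1) unfolding eventually_at by (intro exI[of _ \<epsilon>]) auto
qed

text \<open>Dominated convergence: the mean value theorem bounds the quotients by a constant, and
  shifts of length at most 1 keep them supported in one fixed ball, on which \<open>d\<close> is
  integrable.\<close>

lemma integral_mult_diff_quot_tendsto:
  assumes \<phi>: "\<phi> \<in> test_functions \<Omega>" and d: "sq_integrable d"
    and h: "h \<longlonglongrightarrow> 0" "\<And>n. h n \<noteq> 0" "\<And>n. \<bar>h n\<bar> \<le> 1"
  shows "(\<lambda>n. \<integral>x. d x * diff_quot i (h n) \<phi> x \<partial>lebesgue) \<longlonglongrightarrow> (\<integral>x. d x * pd i \<phi> x \<partial>lebesgue)"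
proof -
  have C: "Ck_on 1 UNIV \<phi>"
    using \<phi> by (simp add: test_functions_def)
  note cont = Ck_on_1_D(2,3)[OF C]
  obtain R where R: "\<And>x. norm x > R \<Longrightarrow> \<phi> x = 0" "\<And>x i. norm x > R \<Longrightarrow> pd i \<phi> x = 0"
    using test_functions_bounded[OF \<phi>] by blast
  have "bounded (pd i \<phi> ` cball 0 R)"
    by (intro compact_imp_bounded compact_continuous_image continuous_on_subset[OF cont(1)]) auto
  then obtain M0 where M0: "\<And>x. norm x \<le> R \<Longrightarrow> \<bar>pd i \<phi> x\<bar> \<le> M0"
    unfolding bounded_iff by (metis image_eqI mem_cball_0 real_norm_def)
  \<comment> \<open>If \<open>R\<close> is negative the ball is empty and \<open>M0\<close> may be
    negative, while the bound must also hold where the derivative vanishes.\<close>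
  define M where "M = max M0 0"
  have M: "\<bar>pd i \<phi> x\<bar> \<le> M" for x
    using M0[of x] R(2)[of x i] by (cases "norm x \<le> R") (auto simp: M_def)
  let ?B = "indicator (cball 0 (R + 1)) :: real^3 \<Rightarrow> real"
  have B: "\<bar>diff_quot i (h n) \<phi> x\<bar> \<le> M * ?B x" for n x
  proof (cases "x \<in> cball 0 (R + 1)")
    case True
    then show ?thesis using abs_diff_quot_le[OF C M h(2)] by simp
  next
    case False
    have "norm x \<le> norm (x + h n *\<^sub>R axis i 1) + norm (h n *\<^sub>R axis i 1 :: real^3)"
      using norm_triangle_ineq4[of "x + h n *\<^sub>R axis i 1" "h n *\<^sub>R axis i 1"] by simp
    then have "norm (x + h n *\<^sub>R axis i 1) > R" "norm x > R"
      using False h(3)[of n] by auto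
    then show ?thesis using False R(1) by (simp add: diff_quot_def)
  qed
  have "(norm (?B x))\<^sup>2 = ?B x" for x
    by (simp add: indicator_def)
  then have "sq_integrable ?B"
    using lmeasurable_cball[of "0 :: real^3" "R + 1"]
    by (simp add: sq_integrable_def lmeasurable_iff_integrable borel_measurable_integrable)
  then have int: "integrable lebesgue (\<lambda>x. \<bar>d x\<bar> * ?B x)"
    using sq_integrable_inner[OF sq_integrable_norm[OF d]] by simp
  show ?thesis
  proof (rule integral_dominated_convergence[where w = "\<lambda>x. M * (\<bar>d x\<bar> * ?B x)"])
    have dm: "d \<in> borel_measurable lebesgue"
      using d by (simp add: sq_integrable_def)
    have "(\<lambda>x. pd i \<phi> x) \<in> borel_measurable lebesgue"
      using borel_measurable_continuous_onI[OF cont(1)] by (simp add: measurable_completion)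
    then show "(\<lambda>x. d x * pd i \<phi> x) \<in> borel_measurable lebesgue"
      using dm by simp
    have "continuous_on UNIV (\<lambda>x. diff_quot i (h n) \<phi> x)" for n
      unfolding diff_quot_def using h(2)[of n]
      by (intro continuous_intros continuous_on_compose2[OF cont(2)]) auto
    then have "diff_quot i (h n) \<phi> \<in> borel_measurable lebesgue" for n
      by (simp add: borel_measurable_continuous_onI measurable_completion)
    then show "(\<lambda>x. d x * diff_quot i (h n) \<phi> x) \<in> borel_measurable lebesgue" for n
      using dm by simp
    show "integrable lebesgue (\<lambda>x. M * (\<bar>d x\<bar> * ?B x))"
      using int by simp
    show "AE x in lebesgue. (\<lambda>n. d x * diff_quot i (h n) \<phi> x) \<longlonglongrightarrow> d x * pd i \<phi> x"
      using h by (intro AE_I2 tendsto_intros filterlim_compose[OF diff_quot_tendsto_pd[OF C]])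
        (simp add: filterlim_at)
    show "AE x in lebesgue. norm (d x * diff_quot i (h n) \<phi> x) \<le> M * (\<bar>d x\<bar> * ?B x)" for n
      using mult_left_mono[OF B abs_ge_zero] by (intro AE_I2) (simp add: abs_mult mult_ac)
  qed
qed

lemma integral_lebesgue_translation:
  fixes g :: "real^3 \<Rightarrow> real"
  assumes "continuous_on UNIV g"
  shows "(\<integral>x. g (x + a) \<partial>lebesgue) = (\<integral>x. g x \<partial>lebesgue)"
proof -
  have g: "g \<in> borel_measurable borel"
    using assms by (rule borel_measurable_continuous_onI)
  have g': "(\<lambda>x. g (x + a)) \<in> borel_measurable borel"
    using assms by (intro borel_measurable_continuous_onI continuous_on_compose2[OF assms] continuous_intros) auto
  have "(\<integral>x. g x \<partial>lborel) = (\<integral>x. g x \<partial>distr lborel borel ((+) a))"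
    by (simp add: lborel_distr_plus)
  also have "\<dots> = (\<integral>x. g (x + a) \<partial>lborel)"
    using g by (subst integral_distr) (simp_all add: add.commute)
  finally show ?thesis
    using g g' by (simp add: integral_completion)
qed

text \<open>Summation by parts for difference quotients: translation invariance moves a forward
  quotient of \<open>\<psi>\<close> onto a backward quotient of \<open>\<phi>\<close>, exactly for
  every step h; both sides converge as h tends to 0.\<close>

lemma integral_by_parts:
  fixes \<phi> \<psi> :: "real^3 \<Rightarrow> real"
  assumes \<phi>: "\<phi> \<in> test_functions \<Omega>" and \<psi>: "\<psi> \<in> test_functions \<Omega>"
  shows "(\<integral>x. \<phi> x * pd i \<psi> x \<partial>lebesgue) = - (\<integral>x. pd i \<phi> x * \<psi> x \<partial>lebesgue)"
proof -
  have C: "continuous_on UNIV \<phi>" "continuous_on UNIV \<psi>"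
    using assms by (auto simp: test_functions_def intro: Ck_on_1_D)
  have h: "(\<lambda>n. inverse (real (Suc n))) \<longlonglongrightarrow> 0"
    by (rule LIMSEQ_inverse_real_of_nat)
  have le: "inverse (real (Suc n)) \<le> 1" for n
    by (simp add: divide_simps)
  let ?h = "\<lambda>n. inverse (real (Suc n))"
  have 1: "(\<lambda>n. \<integral>x. \<phi> x * diff_quot i (?h n) \<psi> x \<partial>lebesgue) \<longlonglongrightarrow> (\<integral>x. \<phi> x * pd i \<psi> x \<partial>lebesgue)"
    using h le by (intro integral_mult_diff_quot_tendsto[OF \<psi> test_functions_sq_integrable(1)[OF \<phi>]]) auto
  have 2: "(\<lambda>n. \<integral>x. \<psi> x * diff_quot i (- ?h n) \<phi> x \<partial>lebesgue) \<longlonglongrightarrow> (\<integral>x. \<psi> x * pd i \<phi> x \<partial>lebesgue)"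
    using tendsto_minus[OF h] le
    by (intro integral_mult_diff_quot_tendsto[OF \<phi> test_functions_sq_integrable(1)[OF \<psi>]]) auto
  have "(\<integral>x. \<phi> x * diff_quot i h \<psi> x \<partial>lebesgue) = - (\<integral>x. \<psi> x * diff_quot i (- h) \<phi> x \<partial>lebesgue)"
    if "h \<noteq> 0" for h
  proof -
    let ?a = "h *\<^sub>R axis i 1 :: real^3"
    let ?g = "\<lambda>x. \<phi> (x - ?a) * \<psi> x"
    have cg: "continuous_on UNIV ?g"
      by (intro continuous_intros C(2) continuous_on_compose2[OF C(1)]) auto
    obtain R where R: "\<And>x. norm x > R \<Longrightarrow> \<psi> x = 0" "\<And>x i. norm x > R \<Longrightarrow> pd i \<psi> x = 0"
      using test_functions_bounded[OF \<psi>] by blast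
    have cs: "continuous_on UNIV (\<lambda>x. \<phi> x * \<psi> (x + ?a))"
      by (intro continuous_intros C(1) continuous_on_compose2[OF C(2)]) auto
    have shift: "(\<integral>x. \<phi> x * \<psi> (x + ?a) \<partial>lebesgue) = (\<integral>x. ?g x \<partial>lebesgue)"
      using integral_lebesgue_translation[OF cg, of ?a] by simp
    have int: "integrable lebesgue (\<lambda>x. f x * g x)"
      if "continuous_on UNIV f" "continuous_on UNIV g" "\<And>x. norm x > R \<Longrightarrow> g x = 0" for f g :: "real^3 \<Rightarrow> real" and R
    proof -
      have "integrable lborel (\<lambda>x. indicator (cball 0 R) x *\<^sub>R (f x * g x))"
        using that by (intro borel_integrable_compact continuous_intros) (auto intro: continuous_on_subset)
      also have "(\<lambda>x. indicator (cball 0 R) x *\<^sub>R (f x * g x)) = (\<lambda>x. f x * g x)"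
        using that(3) by (auto simp: fun_eq_iff indicator_def not_le)
      finally show ?thesis
        using integrable_completion[of "\<lambda>x. f x * g x" lborel] by auto
    qed
    have i1: "integrable lebesgue (\<lambda>x. \<phi> x * \<psi> x)"
      using int[OF C R(1)] by blast
    have i2: "integrable lebesgue ?g"
      by (rule int[OF _ C(2) R(1)]) (auto intro!: continuous_intros continuous_on_compose2[OF C(1)])
    have i3: "integrable lebesgue (\<lambda>x. \<phi> x * \<psi> (x + ?a))"
    proof (rule int[OF C(1), of _ "R + norm ?a"])
      show "continuous_on UNIV (\<lambda>x. \<psi> (x + ?a))"
        by (intro continuous_intros continuous_on_compose2[OF C(2)]) auto
      show "\<psi> (x + ?a) = 0" if "norm x > R + norm ?a" for x
        using that norm_triangle_ineq4[of "x + ?a" ?a] by (intro R(1)) simp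
    qed
    have "(\<integral>x. \<phi> x * diff_quot i h \<psi> x \<partial>lebesgue) = (\<integral>x. (\<phi> x * \<psi> (x + ?a) - \<phi> x * \<psi> x) / h \<partial>lebesgue)"
      by (simp add: diff_quot_def algebra_simps)
    also have "\<dots> = ((\<integral>x. ?g x \<partial>lebesgue) - (\<integral>x. \<phi> x * \<psi> x \<partial>lebesgue)) / h"
      by (simp add: Bochner_Integration.integral_diff[OF i3 i1] shift)
    also have "\<dots> = (\<integral>x. (?g x - \<phi> x * \<psi> x) / h \<partial>lebesgue)"
      by (simp add: Bochner_Integration.integral_diff[OF i2 i1])
    also have "\<dots> = (\<integral>x. - (\<psi> x * diff_quot i (- h) \<phi> x) \<partial>lebesgue)"
      using that by (intro Bochner_Integration.integral_cong) (simp_all add: diff_quot_def field_simps)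
    finally show ?thesis by simp
  qed
  then have "(\<integral>x. \<phi> x * diff_quot i (?h n) \<psi> x \<partial>lebesgue) = - (\<integral>x. \<psi> x * diff_quot i (- ?h n) \<phi> x \<partial>lebesgue)" for n
    by (metis inverse_nonzero_iff_nonzero of_nat_eq_0_iff nat.distinct(1))
  then have "(\<lambda>n. \<integral>x. \<phi> x * diff_quot i (?h n) \<psi> x \<partial>lebesgue) \<longlonglongrightarrow> - (\<integral>x. \<psi> x * pd i \<phi> x \<partial>lebesgue)"
    by (simp only: tendsto_minus[OF 2])
  note LIMSEQ_unique[OF 1 this]
  also have "(\<integral>x. \<psi> x * pd i \<phi> x \<partial>lebesgue) = (\<integral>x. pd i \<phi> x * \<psi> x \<partial>lebesgue)"
    by (intro Bochner_Integration.integral_cong refl mult.commute)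
  finally show ?thesis .
qed

section \<open>Test fields, classical gradients and weak gradients\<close>

lemma compact_closure_subset:
  fixes S :: "'a::euclidean_space set"
  assumes "compact K" "closure S \<subseteq> K"
  shows "compact (closure S)"
  using assms by (meson bounded_subset closed_closure compact_eq_bounded_closed)

lemma test_functions_component:
  assumes "\<psi> \<in> test_functions \<Omega>"
  shows "(\<lambda>x. \<psi> x $ j) \<in> test_functions \<Omega>" "pd i (\<lambda>x. \<psi> x $ j) x = pd i \<psi> x $ j"
proof -
  have C: "Ck_on 1 UNIV \<psi>" and K: "compact (closure {x. \<psi> x \<noteq> 0})" "closure {x. \<psi> x \<noteq> 0} \<subseteq> \<Omega>"
    using assms by (auto simp: test_functions_def)
  have d: "((\<lambda>x. \<psi> x $ j) has_derivative (\<lambda>v. frechet_derivative \<psi> (at x) v $ j)) (at x)" for x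
    using bounded_linear.has_derivative[OF bounded_linear_vec_nth Ck_on_1_D(1)[OF C]] .
  then show "pd i (\<lambda>x. \<psi> x $ j) x = pd i \<psi> x $ j"
    by (simp add: pd_eqI[OF d] pd_def)
  have "Ck_on 1 UNIV (\<lambda>x. \<psi> x $ j)"
  proof (rule Ck_on_1_I[OF d])
    show "continuous_on UNIV (\<lambda>x. frechet_derivative \<psi> (at x) (axis i 1) $ j)" for i
      using continuous_on_component[OF Ck_on_1_D(2)[OF C]] by (simp add: pd_def)
  qed
  moreover have "closure {x. \<psi> x $ j \<noteq> 0} \<subseteq> closure {x. \<psi> x \<noteq> 0}"
    by (rule closure_mono) auto
  ultimately show "(\<lambda>x. \<psi> x $ j) \<in> test_functions \<Omega>"
    using K compact_closure_subset[OF K(1)] unfolding test_functions_def by blast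
qed

lemma test_functions_divergence:
  assumes "\<psi> \<in> test_functions \<Omega>"
  shows "divergence \<psi> x = (\<Sum>i\<in>UNIV. pd i (\<lambda>x. \<psi> x $ i) x)" "sq_integrable (divergence \<psi>)"
proof -
  show 1: "divergence \<psi> x = (\<Sum>i\<in>UNIV. pd i (\<lambda>x. \<psi> x $ i) x)" for x
    by (simp add: divergence_def test_functions_component(2)[OF assms])
  obtain R where R: "\<And>x. norm x > R \<Longrightarrow> \<psi> x = 0" "\<And>x i. norm x > R \<Longrightarrow> pd i \<psi> x = 0"
    using test_functions_bounded[OF assms] by blast
  have C: "Ck_on 1 UNIV \<psi>"
    using assms by (simp add: test_functions_def)
  show "sq_integrable (divergence \<psi>)"
  proof (rule sq_integrable_continuous)
    show "continuous_on UNIV (divergence \<psi>)"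
      unfolding divergence_def[abs_def] by (intro continuous_intros Ck_on_1_D(2)[OF C])
    show "divergence \<psi> x = 0" if "norm x > R" for x
      using R(2)[OF that] by (simp add: divergence_def)
  qed
qed

lemma test_functions_gradient_sq_integrable:
  assumes "\<phi> \<in> test_functions \<Omega>"
  shows "sq_integrable (gradient \<phi>)"
proof -
  obtain R where R: "\<And>x. norm x > R \<Longrightarrow> \<phi> x = 0" "\<And>x i. norm x > R \<Longrightarrow> pd i \<phi> x = 0"
    using test_functions_bounded[OF assms] by blast
  have C: "Ck_on 1 UNIV \<phi>"
    using assms by (simp add: test_functions_def)
  show ?thesis
  proof (rule sq_integrable_continuous)
    show "continuous_on UNIV (gradient \<phi>)"
      unfolding gradient_def[abs_def] by (intro continuous_intros Ck_on_1_D(2)[OF C])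
    show "gradient \<phi> x = 0" if "norm x > R" for x
      using R(2)[OF that] by (simp add: gradient_def vec_eq_iff)
  qed
qed

text \<open>Integration by parts in each component. This puts gradients of test functions into
  \<open>\<A> \<Omega>\<close>, both for reading off that fields of \<open>V0\<close> are divergence
  free and for the bump function that refutes bounded eigenvalues.\<close>

lemma has_weak_grad_test_function:
  assumes \<phi>: "\<phi> \<in> test_functions \<Omega>"
  shows "has_weak_grad \<Omega> (L2_of \<phi>) (L2_of (gradient \<phi>))"
proof -
  note sq = test_functions_sq_integrable(1)[OF \<phi>] test_functions_gradient_sq_integrable[OF \<phi>]
  have out: "\<phi> x = 0" "gradient \<phi> x = 0" if "x \<notin> \<Omega>" for x
  proof -
    have "x \<notin> closure {x. \<phi> x \<noteq> 0}"
      using that \<phi> by (auto simp: test_functions_def)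
    with test_functions_outside[OF \<phi> this] show "\<phi> x = 0" "gradient \<phi> x = 0"
      by (simp_all add: gradient_def vec_eq_iff)
  qed
  have on: "L2_of \<phi> \<in> L2_on \<Omega>" "L2_of (gradient \<phi>) \<in> L2_on \<Omega>"
    using sq out unfolding L2_on_def by blast+
  have "L2_of (gradient \<phi>) \<bullet> L2_of \<psi> = - (L2_of \<phi> \<bullet> L2_of (divergence \<psi>))"
    if \<psi>: "\<psi> \<in> test_functions \<Omega>" for \<psi> :: "real^3 \<Rightarrow> real^3"
  proof -
    note \<psi>i = test_functions_component(1)[OF \<psi>]
    have i1: "integrable lebesgue (\<lambda>x. pd i \<phi> x * \<psi> x $ i)" for i
      using sq_integrable_inner[OF test_functions_sq_integrable(2)[OF \<phi>] test_functions_sq_integrable(1)[OF \<psi>i]] by simp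
    have i2: "integrable lebesgue (\<lambda>x. \<phi> x * pd i (\<lambda>x. \<psi> x $ i) x)" for i
      using sq_integrable_inner[OF test_functions_sq_integrable(1)[OF \<phi>] test_functions_sq_integrable(2)[OF \<psi>i]] by simp
    have "L2_of (gradient \<phi>) \<bullet> L2_of \<psi> = (\<integral>x. (\<Sum>i\<in>UNIV. pd i \<phi> x * \<psi> x $ i) \<partial>lebesgue)"
      by (simp add: inner_L2_of[OF sq(2) test_functions_sq_integrable(1)[OF \<psi>]] inner_vec_def gradient_def)
    also have "\<dots> = (\<Sum>i\<in>UNIV. \<integral>x. pd i \<phi> x * \<psi> x $ i \<partial>lebesgue)"
      by (intro Bochner_Integration.integral_sum i1)
    also have "\<dots> = (\<Sum>i\<in>UNIV. - (\<integral>x. \<phi> x * pd i (\<lambda>x. \<psi> x $ i) x \<partial>lebesgue))"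
      by (intro sum.cong refl) (simp add: integral_by_parts[OF \<phi> \<psi>i])
    also have "\<dots> = - (\<integral>x. (\<Sum>i\<in>UNIV. \<phi> x * pd i (\<lambda>x. \<psi> x $ i) x) \<partial>lebesgue)"
      unfolding sum_negf by (subst Bochner_Integration.integral_sum) (use i2 in auto)
    also have "(\<integral>x. (\<Sum>i\<in>UNIV. \<phi> x * pd i (\<lambda>x. \<psi> x $ i) x) \<partial>lebesgue) = L2_of \<phi> \<bullet> L2_of (divergence \<psi>)"
      by (simp add: inner_L2_of[OF sq(1) test_functions_divergence(2)[OF \<psi>]]
          test_functions_divergence(1)[OF \<psi>] sum_distrib_left)
    finally show ?thesis .
  qed
  with on show ?thesis unfolding has_weak_grad_def by blast
qed

text \<open>The orthogonality hypothesis cannot be applied to \<open>pd i \<phi>\<close> itself, but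
  it applies to the difference quotients with small step.\<close>

lemma orthogonal_pd_test_function:
  fixes e \<phi> :: "real^3 \<Rightarrow> real"
  assumes "open \<Omega>" and e: "sq_integrable e"
    and orth: "\<And>\<eta>. \<eta> \<in> test_functions \<Omega> \<Longrightarrow> (\<integral>x. e x * \<eta> x \<partial>lebesgue) = 0"
    and \<phi>: "\<phi> \<in> test_functions \<Omega>"
  shows "(\<integral>x. e x * pd i \<phi> x \<partial>lebesgue) = 0"
proof -
  let ?h = "\<lambda>n. inverse (real (Suc n))"
  have h: "?h \<longlonglongrightarrow> 0"
    by (rule LIMSEQ_inverse_real_of_nat)
  have "(\<lambda>n. \<integral>x. e x * diff_quot i (?h n) \<phi> x \<partial>lebesgue) \<longlonglongrightarrow> (\<integral>x. e x * pd i \<phi> x \<partial>lebesgue)"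
    by (rule integral_mult_diff_quot_tendsto[OF \<phi> e h]) (simp_all add: divide_simps)
  moreover have "\<forall>\<^sub>F n in sequentially. (\<integral>x. e x * diff_quot i (?h n) \<phi> x \<partial>lebesgue) = 0"
  proof -
    have "filterlim ?h (at 0) sequentially"
      using h by (simp add: filterlim_at)
    from eventually_compose_filterlim[OF diff_quot_test_function[OF \<phi> \<open>open \<Omega>\<close>, of i] this]
    show ?thesis by (rule eventually_mono) (rule orth)
  qed
  then have "(\<lambda>n. \<integral>x. e x * diff_quot i (?h n) \<phi> x \<partial>lebesgue) \<longlonglongrightarrow> 0"
    by (rule tendsto_eventually)
  ultimately show ?thesis by (rule LIMSEQ_unique)
qed

text \<open>Two weak divergences of one field agree on test functions.  They also agree on \<open>div \<psi>\<close>, which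
  is only continuous for a test field \<open>\<psi>\<close>, because it is a weak limit of difference quotients of
  \<open>\<psi>\<close>, and these are test functions.\<close>

lemma has_weak_grad_transfer_div:
  assumes "open \<Omega>" and D: "has_weak_div \<Omega> V D" and D': "has_weak_div \<Omega> V D'" and G: "has_weak_grad \<Omega> D G"
  shows "has_weak_grad \<Omega> D' G"
proof -
  obtain e where e: "sq_integrable e" "D - D' = L2_of e"
    using L2_of_cases by blast
  have orth: "(\<integral>x. e x * \<eta> x \<partial>lebesgue) = 0" if \<eta>: "\<eta> \<in> test_functions \<Omega>" for \<eta>
  proof -
    have "(\<integral>x. e x * \<eta> x \<partial>lebesgue) = (D - D') \<bullet> L2_of \<eta>"
      by (simp add: e(2) inner_L2_of[OF e(1) test_functions_sq_integrable(1)[OF \<eta>]])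
    also have "\<dots> = 0"
      using D D' \<eta> by (simp add: has_weak_div_def inner_diff_left)
    finally show ?thesis .
  qed
  have "D' \<bullet> L2_of (divergence \<psi>) = D \<bullet> L2_of (divergence \<psi>)"
    if \<psi>: "\<psi> \<in> test_functions \<Omega>" for \<psi> :: "real^3 \<Rightarrow> real^3"
  proof -
    note \<psi>i = test_functions_component(1)[OF \<psi>]
    have "(D - D') \<bullet> L2_of (divergence \<psi>) = (\<integral>x. (\<Sum>i\<in>UNIV. e x * pd i (\<lambda>x. \<psi> x $ i) x) \<partial>lebesgue)"
      by (simp add: e(2) inner_L2_of[OF e(1) test_functions_divergence(2)[OF \<psi>]]
          test_functions_divergence(1)[OF \<psi>] sum_distrib_left)
    also have "\<dots> = (\<Sum>i\<in>UNIV. \<integral>x. e x * pd i (\<lambda>x. \<psi> x $ i) x \<partial>lebesgue)"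
      using sq_integrable_inner[OF e(1) test_functions_sq_integrable(2)[OF \<psi>i]]
      by (intro Bochner_Integration.integral_sum) simp
    also have "\<dots> = 0"
      using orthogonal_pd_test_function[OF \<open>open \<Omega>\<close> e(1) orth \<psi>i] by simp
    finally show ?thesis by (simp add: inner_diff_left)
  qed
  then show ?thesis
    using G D' by (simp add: has_weak_grad_def has_weak_div_def)
qed

section \<open>Test functions with steep gradients\<close>

text \<open>Squaring removes the kink at 0: the first-order remainder is at most h^2 in each of the
  four sign cases of t and t + h.\<close>

lemma square_max_0_has_derivative:
  "((\<lambda>t::real. (max 0 t)\<^sup>2) has_real_derivative 2 * max 0 t) (at t)"
proof -
  have le: "\<bar>(max 0 (t + h))\<^sup>2 - (max 0 t)\<^sup>2 - 2 * max 0 t * h\<bar> \<le> h\<^sup>2" for h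
  proof (cases "0 \<le> t")
    case True
    show ?thesis
    proof (cases "0 \<le> t + h")
      case True
      with \<open>0 \<le> t\<close> show ?thesis by (simp add: power2_eq_square algebra_simps)
    next
      case False
      \<comment> \<open>Here the remainder is -t^2 - 2th. It is nonnegative because th <= -t^2, and
        at most h^2 because (t + h)^2 >= 0.\<close>
      then have "0 \<le> t * (- t - h)" using \<open>0 \<le> t\<close> by (intro mult_nonneg_nonneg) auto
      then have "t * h \<le> - (t * t)"
        by (simp add: algebra_simps)
      moreover have "0 \<le> (t + h) * (t + h)" "0 \<le> t * t" "0 \<le> h * h"
        by simp_all
      ultimately have "\<bar>- (t * t) - 2 * (t * h)\<bar> \<le> h * h"
        unfolding distrib_left distrib_right mult.commute[of h t] by linarith
      with False \<open>0 \<le> t\<close> show ?thesis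
        by (simp add: power2_eq_square algebra_simps)
    qed
  next
    case False
    show ?thesis
    proof (cases "0 \<le> t + h")
      case True
      with False have "(t + h)\<^sup>2 \<le> h\<^sup>2" by (intro power_mono) auto
      with True False show ?thesis by simp
    next
      case False
      with \<open>\<not> 0 \<le> t\<close> show ?thesis by simp
    qed
  qed
  have "((\<lambda>h. ((max 0 (t + h))\<^sup>2 - (max 0 t)\<^sup>2) / h) \<longlongrightarrow> 2 * max 0 t) (at 0)"
  proof (rule LIM_zero_cancel, rule Lim_null_comparison)
    show "\<forall>\<^sub>F h in at 0. norm (((max 0 (t + h))\<^sup>2 - (max 0 t)\<^sup>2) / h - 2 * max 0 t) \<le> \<bar>h\<bar>"
    proof (rule eventually_at_filter[THEN iffD2], intro always_eventually allI impI)
      fix h :: real assume "h \<noteq> 0"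
      then have "\<bar>((max 0 (t + h))\<^sup>2 - (max 0 t)\<^sup>2) / h - 2 * max 0 t\<bar> =
          \<bar>(max 0 (t + h))\<^sup>2 - (max 0 t)\<^sup>2 - 2 * max 0 t * h\<bar> / \<bar>h\<bar>"
        by (simp add: abs_divide[symmetric] diff_divide_distrib)
      also have "\<dots> \<le> h\<^sup>2 / \<bar>h\<bar>"
        by (intro divide_right_mono le) simp
      also have "\<dots> = \<bar>h\<bar>"
        using \<open>h \<noteq> 0\<close> by (simp add: power2_eq_square abs_if)
      finally show "norm (((max 0 (t + h))\<^sup>2 - (max 0 t)\<^sup>2) / h - 2 * max 0 t) \<le> \<bar>h\<bar>"
        by simp
    qed
    show "((\<lambda>h::real. \<bar>h\<bar>) \<longlongrightarrow> 0) (at 0)"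
      by (rule tendsto_rabs_zero) simp
  qed
  then show ?thesis by (simp add: DERIV_def)
qed

text \<open>The outer square makes the cut-off continuously differentiable across the sphere, which
  is the regularity that \<open>test_functions\<close> demands.\<close>

definition bump :: "real^3 \<Rightarrow> real \<Rightarrow> real^3 \<Rightarrow> real" where
  "bump p r x = (max 0 (r\<^sup>2 - (x - p) \<bullet> (x - p)))\<^sup>2"

lemma bump_nonzero_iff:
  assumes "r > 0" shows "bump p r x \<noteq> 0 \<longleftrightarrow> x \<in> ball p r"
proof -
  have "bump p r x \<noteq> 0 \<longleftrightarrow> (norm (x - p))\<^sup>2 < r\<^sup>2"
    by (auto simp: bump_def power2_norm_eq_inner max_def)
  also have "\<dots> \<longleftrightarrow> norm (x - p) < r"
    using assms by (auto intro: power_strict_mono dest: power2_less_imp_less)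
  finally show ?thesis
    by (simp add: dist_norm norm_minus_commute)
qed

lemma bump_test_function:
  assumes "r > 0" "cball p r \<subseteq> \<Omega>"
  shows "bump p r \<in> test_functions \<Omega>"
proof -
  have d: "(bump p r has_derivative (\<lambda>v. 2 * max 0 (r\<^sup>2 - (x - p) \<bullet> (x - p)) * (- 2 * ((x - p) \<bullet> v)))) (at x)" for x
  proof -
    have "((\<lambda>x. r\<^sup>2 - (x - p) \<bullet> (x - p)) has_derivative (\<lambda>v. - 2 * ((x - p) \<bullet> v))) (at x)"
      by (auto intro!: derivative_eq_intros simp: inner_commute)
    from has_derivative_compose[OF this square_max_0_has_derivative[unfolded has_field_derivative_def]]
    show ?thesis by (simp add: bump_def[abs_def])
  qed
  have "Ck_on 1 UNIV (bump p r)"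
    by (rule Ck_on_1_I[OF d]) (intro continuous_intros)
  moreover have "closure {x. bump p r x \<noteq> 0} = cball p r"
    using assms by (simp only: bump_nonzero_iff Collect_mem_eq closure_ball)
  ultimately show ?thesis
    using assms(2) by (simp add: test_functions_def del: compact_closure Ck_on.simps One_nat_def)
qed

lemma L2_of_bump_nonzero:
  assumes "r > 0"
  shows "L2_of (bump p r) \<noteq> 0"
proof
  assume "L2_of (bump p r) = 0"
  moreover have sq: "sq_integrable (bump p r)"
    using test_functions_sq_integrable(1)[OF bump_test_function[OF assms subset_UNIV]] .
  ultimately have "(\<integral>x. bump p r x * bump p r x \<partial>lebesgue) = 0"
    using inner_L2_of[OF sq sq] by simp
  then have "AE x in lebesgue. bump p r x * bump p r x = 0"
    using sq_integrable_inner[OF sq sq] by (subst (asm) integral_nonneg_eq_0_iff_AE) auto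
  then have "AE x in lebesgue. x \<notin> ball p r"
    using bump_nonzero_iff[OF assms] by (auto elim: AE_mp)
  then have "negligible (ball p r)"
    by (simp add: negligible_iff_null_sets AE_iff_null_sets)
  then show False
    using open_not_negligible[OF open_ball, of p r] assms by simp
qed

text \<open>With xi = (x_i - p) phi, integrating phi against the i-th derivative of xi by parts
  gives |phi|^2 = -2 (xi, d_i phi). Cauchy-Schwarz and |xi| <= rho |phi| finish after division by
  the norm of phi.\<close>

lemma Poincare_inequality_slab:
  assumes \<phi>: "\<phi> \<in> test_functions \<Omega>" and \<rho>: "\<And>x. \<phi> x \<noteq> 0 \<Longrightarrow> \<bar>x $ i - p\<bar> \<le> \<rho>" "0 \<le> \<rho>"
  shows "norm (L2_of \<phi>) \<le> 2 * \<rho> * norm (L2_of (gradient \<phi>))"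
proof -
  define \<xi> where "\<xi> x = (x $ i - p) * \<phi> x" for x
  have C: "Ck_on 1 UNIV \<phi>" and K: "compact (closure {x. \<phi> x \<noteq> 0})" "closure {x. \<phi> x \<noteq> 0} \<subseteq> \<Omega>"
    using \<phi> by (auto simp: test_functions_def)
  have d: "(\<xi> has_derivative (\<lambda>v. (x $ i - p) * frechet_derivative \<phi> (at x) v + v $ i * \<phi> x)) (at x)" for x
  proof -
    have "((\<lambda>x. x $ i - p) has_derivative (\<lambda>v. v $ i)) (at x)"
      using bounded_linear.has_derivative[OF bounded_linear_vec_nth has_derivative_ident]
      by (auto intro!: derivative_eq_intros)
    from has_derivative_mult[OF this Ck_on_1_D(1)[OF C]]
    show ?thesis by (simp add: \<xi>_def[abs_def])
  qed
  have pd: "pd i \<xi> x = \<phi> x + (x $ i - p) * pd i \<phi> x" for x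
    unfolding pd_eqI[OF d] by (simp add: pd_def)
  have "Ck_on 1 UNIV \<xi>"
  proof (rule Ck_on_1_I[OF d])
    have "continuous_on UNIV (\<lambda>x. (x $ i - p) * pd j \<phi> x + axis j 1 $ i * \<phi> x)" for j
      by (intro continuous_intros Ck_on_1_D[OF C])
    then show "continuous_on UNIV (\<lambda>x. (x $ i - p) * frechet_derivative \<phi> (at x) (axis j 1) + axis j 1 $ i * \<phi> x)" for j
      by (simp add: pd_def)
  qed
  moreover have "closure {x. \<xi> x \<noteq> 0} \<subseteq> closure {x. \<phi> x \<noteq> 0}"
    by (rule closure_mono) (auto simp: \<xi>_def)
  ultimately have \<xi>: "\<xi> \<in> test_functions \<Omega>"
    using K compact_closure_subset[OF K(1)] unfolding test_functions_def by blast
  note sq = test_functions_sq_integrable[OF \<phi>] test_functions_sq_integrable[OF \<xi>]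
  have sqg: "sq_integrable (gradient \<phi>)"
    by (rule test_functions_gradient_sq_integrable[OF \<phi>])
  have i1: "integrable lebesgue (\<lambda>x. \<phi> x * \<phi> x)"
    using sq_integrable_inner[OF sq(1) sq(1)] by simp
  have i2: "integrable lebesgue (\<lambda>x. \<xi> x * pd i \<phi> x)"
    using sq_integrable_inner[OF sq(3) sq(2)] by simp
  have "(\<integral>x. \<phi> x * pd i \<xi> x \<partial>lebesgue) = (\<integral>x. \<phi> x * \<phi> x + \<xi> x * pd i \<phi> x \<partial>lebesgue)"
    by (intro Bochner_Integration.integral_cong) (auto simp: pd \<xi>_def algebra_simps)
  also have "\<dots> = (\<integral>x. \<phi> x * \<phi> x \<partial>lebesgue) + (\<integral>x. \<xi> x * pd i \<phi> x \<partial>lebesgue)"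
    by (rule Bochner_Integration.integral_add[OF i1 i2])
  finally have "(\<integral>x. \<phi> x * \<phi> x \<partial>lebesgue) + (\<integral>x. \<xi> x * pd i \<phi> x \<partial>lebesgue) = - (\<integral>x. \<xi> x * pd i \<phi> x \<partial>lebesgue)"
    using integral_by_parts[OF \<phi> \<xi>, of i] by (simp add: mult.commute[of "\<xi> _"])
  then have "L2_of \<phi> \<bullet> L2_of \<phi> = - 2 * (L2_of \<xi> \<bullet> L2_of (pd i \<phi>))"
    by (simp add: inner_L2_of sq)
  also have "\<dots> \<le> 2 * (norm (L2_of \<xi>) * norm (L2_of (pd i \<phi>)))"
    using Cauchy_Schwarz_ineq2[of "L2_of \<xi>" "L2_of (pd i \<phi>)"] by linarith
  also have "\<dots> \<le> 2 * ((\<rho> * norm (L2_of \<phi>)) * norm (L2_of (gradient \<phi>)))"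
  proof -
    have "norm (L2_of \<xi>) \<le> \<rho> * norm (L2_of \<phi>)"
    proof (rule power2_le_imp_le)
      have "(norm (\<xi> x))\<^sup>2 \<le> \<rho>\<^sup>2 * (norm (\<phi> x))\<^sup>2" for x
      proof (cases "\<phi> x = 0")
        case False
        have "(norm (\<xi> x))\<^sup>2 = \<bar>x $ i - p\<bar>\<^sup>2 * (norm (\<phi> x))\<^sup>2"
          by (simp add: \<xi>_def power_mult_distrib)
        also have "\<dots> \<le> \<rho>\<^sup>2 * (norm (\<phi> x))\<^sup>2"
          using \<rho>(1)[OF False] by (intro mult_right_mono power_mono) auto
        finally show ?thesis .
      qed (simp add: \<xi>_def)
      then have "(\<integral>x. (norm (\<xi> x))\<^sup>2 \<partial>lebesgue) \<le> (\<integral>x. \<rho>\<^sup>2 * (norm (\<phi> x))\<^sup>2 \<partial>lebesgue)"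
        using sq by (intro integral_mono) (auto simp: sq_integrable_def)
      then show "(norm (L2_of \<xi>))\<^sup>2 \<le> (\<rho> * norm (L2_of \<phi>))\<^sup>2"
        using sq by (simp add: norm_L2_of power_mult_distrib)
    qed (use \<rho>(2) in simp)
    moreover have "norm (L2_of (pd i \<phi>)) \<le> norm (L2_of (gradient \<phi>))"
    proof (rule power2_le_imp_le)
      have "(norm (pd i \<phi> x))\<^sup>2 \<le> (norm (gradient \<phi> x))\<^sup>2" for x
        using component_le_norm_cart[of "gradient \<phi> x" i] by (intro power_mono) (simp_all add: gradient_def)
      then show "(norm (L2_of (pd i \<phi>)))\<^sup>2 \<le> (norm (L2_of (gradient \<phi>)))\<^sup>2"
        unfolding norm_L2_of[OF sq(2)] norm_L2_of[OF sqg]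
        using sq(2)[of i] sqg by (intro integral_mono) (auto simp: sq_integrable_def)
    qed simp
    ultimately show ?thesis
      using \<rho>(2) by (intro mult_left_mono mult_mono) auto
  qed
  finally show ?thesis
    by (cases "L2_of \<phi> = 0") (use \<rho>(2) in \<open>auto simp: power2_norm_eq_inner[symmetric] power2_eq_square mult_ac\<close>)
qed


lemma exists_test_function_steep_gradient:
  assumes "open \<Omega>" "\<Omega> \<noteq> {}" "L \<ge> 0"
  obtains \<phi> :: "real^3 \<Rightarrow> real" where "\<phi> \<in> test_functions \<Omega>"
    "L * (norm (L2_of \<phi>))\<^sup>2 < (norm (L2_of (gradient \<phi>)))\<^sup>2"
proof -
  obtain p r0 where r0: "r0 > 0" "cball p r0 \<subseteq> \<Omega>"
    using assms open_contains_cball by blast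
  \<comment> \<open>The radius is chosen so that the Poincare constant satisfies
    \<open>(L + 1) * (2 * r) \<le> 1\<close>. Then the gradient norm is at least L + 1 times the
    norm of the bump, and L < (L + 1)^2 makes the claim strict.\<close>
  define r where "r = min r0 (1 / (2 * (L + 1)))"
  have r: "r > 0" "cball p r \<subseteq> \<Omega>"
    using r0 \<open>L \<ge> 0\<close> by (auto simp: r_def)
  let ?\<phi> = "bump p r"
  have \<phi>: "?\<phi> \<in> test_functions \<Omega>"
    by (rule bump_test_function[OF r])
  have pos: "0 < norm (L2_of ?\<phi>)"
    using L2_of_bump_nonzero[OF r(1)] by simp
  have "\<bar>x $ 1 - p $ 1\<bar> \<le> r" if "?\<phi> x \<noteq> 0" for x
    using that component_le_norm_cart[of "x - p" 1] bump_nonzero_iff[OF r(1), of p x]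
    by (simp add: dist_norm norm_minus_commute)
  from Poincare_inequality_slab[OF \<phi> this]
  have P: "norm (L2_of ?\<phi>) \<le> 2 * r * norm (L2_of (gradient ?\<phi>))"
    using r(1) by simp
  have "(L + 1) * (2 * r) \<le> (L + 1) * (2 * (1 / (2 * (L + 1))))"
    using \<open>L \<ge> 0\<close> by (intro mult_left_mono) (auto simp: r_def)
  also have "\<dots> = 1"
    using \<open>L \<ge> 0\<close> by simp
  finally have Lr: "(L + 1) * (2 * r) \<le> 1" .
  have "(L + 1) * norm (L2_of ?\<phi>) \<le> (L + 1) * (2 * r * norm (L2_of (gradient ?\<phi>)))"
    using P \<open>L \<ge> 0\<close> by (intro mult_left_mono) auto
  also have "\<dots> = (L + 1) * (2 * r) * norm (L2_of (gradient ?\<phi>))"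
    by (simp only: mult.assoc)
  also have "\<dots> \<le> 1 * norm (L2_of (gradient ?\<phi>))"
    by (intro mult_right_mono Lr) simp
  finally have "((L + 1) * norm (L2_of ?\<phi>))\<^sup>2 \<le> (norm (L2_of (gradient ?\<phi>)))\<^sup>2"
    using \<open>L \<ge> 0\<close> by (intro power_mono) auto
  moreover have "L * (norm (L2_of ?\<phi>))\<^sup>2 < (L + 1)\<^sup>2 * (norm (L2_of ?\<phi>))\<^sup>2"
  proof (rule mult_strict_right_mono)
    show "L < (L + 1)\<^sup>2"
      using \<open>L \<ge> 0\<close> by (simp add: power2_sum add_nonneg_pos)
  qed (use pos in simp)
  ultimately show ?thesis
    using that[OF \<phi>] by (simp add: power_mult_distrib)
qed

section \<open>Coefficients in an orthonormal basis\<close>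

lemma orthonormal_partial_sum:
  fixes e :: "nat \<Rightarrow> 'h::real_inner"
  assumes on: "\<And>i j. e i \<bullet> e j = (if i = j then 1 else 0)" and "finite I"
  shows "(\<Sum>j\<in>I. a j *\<^sub>R e j) \<bullet> e i = (if i \<in> I then a i else 0)"
    and "(norm (\<Sum>j\<in>I. a j *\<^sub>R e j))\<^sup>2 = (\<Sum>j\<in>I. (a j)\<^sup>2)"
proof -
  show 1: "(\<Sum>j\<in>I. a j *\<^sub>R e j) \<bullet> e i = (if i \<in> I then a i else 0)" for i
    using \<open>finite I\<close> by (simp add: inner_sum_left on if_distrib cong: if_cong)
  show "(norm (\<Sum>j\<in>I. a j *\<^sub>R e j))\<^sup>2 = (\<Sum>j\<in>I. (a j)\<^sup>2)"
    by (simp add: power2_norm_eq_inner inner_sum_right[where A=I] 1)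
      (simp add: power2_eq_square)
qed

text \<open>The partial sums \<open>P n\<close> are linear contractions and eventually fix each
  basis vector. Hence they converge on the span, and the uniform bound extends this to its
  closure.\<close>

lemma orthonormal_basis_expansion:
  fixes e :: "nat \<Rightarrow> 'h::real_inner"
  assumes e: "orthonormal_basis e M" and F: "F \<in> M"
  shows "(\<lambda>j. (F \<bullet> e j) *\<^sub>R e j) sums F"
proof -
  have on: "e i \<bullet> e j = (if i = j then 1 else 0)" for i j
    using e by (simp add: orthonormal_basis_def)
  define P where "P n y = (\<Sum>j<n. (y \<bullet> e j) *\<^sub>R e j)" for n y
  have P_diff: "P n (x - y) = P n x - P n y" for n x y
    by (simp add: P_def inner_diff_left scaleR_diff_left sum_subtractf)
  have P_le: "norm (P n y) \<le> norm y" for n y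
  proof -
    have "(norm (P n y))\<^sup>2 = P n y \<bullet> y"
      using orthonormal_partial_sum(2)[OF on, of "{..<n}" "\<lambda>j. y \<bullet> e j"]
      by (simp add: P_def inner_sum_left power2_eq_square inner_commute[of y])
    also have "\<dots> \<le> norm (P n y) * norm y"
      by (rule norm_cauchy_schwarz)
    finally show ?thesis
      by (cases "P n y = 0") (auto simp: power2_eq_square)
  qed
  have span: "(\<lambda>n. P n y) \<longlonglongrightarrow> y" if "y \<in> span (range e)" for y
    using that
  proof (induction rule: span_induct_alt)
    case base
    show ?case by (simp add: P_def)
  next
    case (step c x y)
    then obtain i where x: "x = e i" by auto
    have "P n x = x" if "n > i" for n
      using that by (simp add: P_def x on if_distribR if_distrib[of "\<lambda>r. r *\<^sub>R _"] cong: if_cong)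
    then have "(\<lambda>n. P n x) \<longlonglongrightarrow> x"
      by (intro tendsto_eventually) (auto intro: eventually_mono[OF eventually_gt_at_top[of i]])
    then have "(\<lambda>n. c *\<^sub>R P n x + P n y) \<longlonglongrightarrow> c *\<^sub>R x + y"
      using step by (intro tendsto_intros)
    moreover have "P n (c *\<^sub>R x + y) = c *\<^sub>R P n x + P n y" for n
      by (simp add: P_def inner_add_left scaleR_add_left sum.distrib scaleR_sum_right)
    ultimately show ?case by simp
  qed
  have "(\<lambda>n. P n F) \<longlonglongrightarrow> F"
  proof (rule LIMSEQ_I)
    fix \<epsilon> :: real assume \<epsilon>: "\<epsilon> > 0"
    have "F \<in> closure (span (range e))"
      using e F by (simp add: orthonormal_basis_def)
    then obtain y where y: "y \<in> span (range e)" "norm (y - F) < \<epsilon> / 3"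
      using \<epsilon> unfolding closure_approachable by (metis dist_norm divide_pos_pos zero_less_numeral)
    obtain N where N: "\<And>n. n \<ge> N \<Longrightarrow> norm (P n y - y) < \<epsilon> / 3"
      using LIMSEQ_D[OF span[OF y(1)], of "\<epsilon> / 3"] \<epsilon> by auto
    have "norm (P n F - F) < \<epsilon>" if "n \<ge> N" for n
    proof -
      \<comment> \<open>Each of the three terms is below one third of the tolerance, the last one by
        contractivity.\<close>
      have "norm (P n F - F) = norm ((y - F) + (P n y - y) - P n (y - F))"
        by (simp add: P_diff)
      also have "\<dots> \<le> norm (y - F) + norm (P n y - y) + norm (P n (y - F))"
        by (meson add_right_mono norm_triangle_ineq norm_triangle_ineq4 order_trans)
      also have "\<dots> < \<epsilon>"
        using N[OF that] y(2) P_le[of n "y - F"] by linarith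
      finally show ?thesis .
    qed
    then show "\<exists>N. \<forall>n\<ge>N. norm (P n F - F) < \<epsilon>" by blast
  qed
  then show ?thesis by (simp add: sums_def P_def)
qed

text \<open>By Pythagoras the tails of the vector series have the same squared norms as the tails of
  the numerical series, so completeness gives convergence. Continuity of the inner product then
  identifies the coefficients.\<close>

lemma Riesz_Fischer:
  fixes e :: "nat \<Rightarrow> 'h::{real_inner, banach}"
  assumes e: "orthonormal_basis e M" and a: "summable (\<lambda>j. (a j)\<^sup>2)"
  shows "(\<Sum>j. a j *\<^sub>R e j) \<in> M" and "(\<Sum>j. a j *\<^sub>R e j) \<bullet> e i = a i"
proof -
  have on: "e i \<bullet> e j = (if i = j then 1 else 0)" for i j
    using e by (simp add: orthonormal_basis_def)
  have s: "summable (\<lambda>j. a j *\<^sub>R e j)"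
    unfolding summable_Cauchy
  proof (intro allI impI)
    fix \<epsilon> :: real assume "\<epsilon> > 0"
    then obtain N where N: "\<And>m n. m \<ge> N \<Longrightarrow> norm (\<Sum>j=m..<n. (a j)\<^sup>2) < \<epsilon>\<^sup>2"
      using a unfolding summable_Cauchy by (metis zero_less_power)
    have "norm (\<Sum>j=m..<n. a j *\<^sub>R e j) < \<epsilon>" if "m \<ge> N" for m n
    proof (rule power2_less_imp_less)
      show "(norm (\<Sum>j=m..<n. a j *\<^sub>R e j))\<^sup>2 < \<epsilon>\<^sup>2"
        using N[OF that, of n] by (subst orthonormal_partial_sum(2)[OF on]) (simp_all add: sum_nonneg)
    qed (use \<open>\<epsilon> > 0\<close> in auto)
    then show "\<exists>N. \<forall>m\<ge>N. \<forall>n. norm (\<Sum>j=m..<n. a j *\<^sub>R e j) < \<epsilon>" by blast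
  qed
  then have lim: "(\<lambda>n. \<Sum>j<n. a j *\<^sub>R e j) \<longlonglongrightarrow> (\<Sum>j. a j *\<^sub>R e j)"
    by (rule summable_LIMSEQ)
  have "(\<Sum>j<n. a j *\<^sub>R e j) \<in> span (range e)" for n
    by (intro span_sum span_scale span_base) auto
  then have "(\<Sum>j. a j *\<^sub>R e j) \<in> closure (span (range e))"
    using lim unfolding closure_sequential by (intro exI[of _ "\<lambda>n. \<Sum>j<n. a j *\<^sub>R e j"]) blast
  then show "(\<Sum>j. a j *\<^sub>R e j) \<in> M"
    using e by (simp add: orthonormal_basis_def)
  have "(\<lambda>n. (\<Sum>j<n. a j *\<^sub>R e j) \<bullet> e i) \<longlonglongrightarrow> (\<Sum>j. a j *\<^sub>R e j) \<bullet> e i"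
    by (intro tendsto_intros lim)
  moreover have "(\<lambda>n. (\<Sum>j<n. a j *\<^sub>R e j) \<bullet> e i) \<longlonglongrightarrow> a i"
    by (intro tendsto_eventually eventually_mono[OF eventually_gt_at_top[of i]])
      (simp add: orthonormal_partial_sum(1)[OF on])
  ultimately show "(\<Sum>j. a j *\<^sub>R e j) \<bullet> e i = a i"
    by (rule LIMSEQ_unique)
qed

lemma subspace_closure:
  fixes S :: "'a::real_normed_vector set"
  assumes S: "subspace S"
  shows "subspace (closure S)"
proof (rule subspaceI)
  show "0 \<in> closure S"
    using S closure_subset subspace_0 by blast
next
  fix x y assume "x \<in> closure S" "y \<in> closure S"
  then obtain f g where "\<And>n. f n \<in> S" "f \<longlonglongrightarrow> x" "\<And>n. g n \<in> S" "g \<longlonglongrightarrow> y"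
    unfolding closure_sequential by blast
  then show "x + y \<in> closure S"
    unfolding closure_sequential
    by (intro exI[of _ "\<lambda>n. f n + g n"] conjI allI subspace_add[OF S] tendsto_intros)
next
  fix c x assume "x \<in> closure S"
  then obtain f where "\<And>n. f n \<in> S" "f \<longlonglongrightarrow> x"
    unfolding closure_sequential by blast
  then show "c *\<^sub>R x \<in> closure S"
    unfolding closure_sequential
    by (intro exI[of _ "\<lambda>n. c *\<^sub>R f n"] conjI allI subspace_scale[OF S] tendsto_intros)
qed

text \<open>Provides the linear structure of \<open>\<A> \<Omega>\<close> from its basis instead of
  from the linearity of weak gradients.\<close>

lemma orthonormal_basis_subspace:
  assumes "orthonormal_basis e M" shows "subspace M"
  using assms subspace_closure[of "span (range e)"] by (auto simp: orthonormal_basis_def)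

lemma bij_betw_scale_W_sp:
  assumes "c \<noteq> 0"
  shows "bij_betw (\<lambda>w j. c *\<^sub>R w j) (W_sp lam m) (W_sp lam m)"
proof -
  have mem: "(\<lambda>j. c *\<^sub>R w j) \<in> W_sp lam m" if w: "w \<in> W_sp lam m" for c w
  proof -
    have "(\<lambda>j. c\<^sup>2 * (lam j powi (2 * m) * ((fst (w j))\<^sup>2 + (snd (w j))\<^sup>2))) summable_on UNIV"
      using w by (intro summable_on_cmult_right) (simp add: W_sp_def)
    then show ?thesis
      by (simp add: W_sp_def algebra_simps power_mult_distrib)
  qed
  show ?thesis
    by (rule bij_betw_byWitness[where f' = "\<lambda>w j. inverse c *\<^sub>R w j"]) (use assms mem in auto)
qed

lemma W_normsq_scale: "W_normsq lam m (\<lambda>j. c *\<^sub>R w j) = c\<^sup>2 * W_normsq lam m w"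
  unfolding W_normsq_def
  by (subst infsum_cmult_right'[symmetric]) (simp add: algebra_simps power_mult_distrib)

section \<open>The operator as a multiplier on gradient fields\<close>

locale grad_div_basis =
  fixes \<Omega> :: "(real^3) set" and \<nu> :: "nat \<Rightarrow> real" and q :: "nat \<Rightarrow> (real^3) L2"
  assumes basis: "grad_div_eigenbasis \<Omega> \<nu> q"
begin

lemma onb: "orthonormal_basis q (\<A> \<Omega>)"
  using basis by (simp add: grad_div_eigenbasis_def)

lemma eigenvalue_ge: "(\<nu> 0)\<^sup>2 \<le> (\<nu> j)\<^sup>2"
  using basis monoD[of "\<lambda>j. (\<nu> j)\<^sup>2" 0 j] by (simp add: grad_div_eigenbasis_def)

lemma eigenvalue0_pos: "0 < (\<nu> 0)\<^sup>2"
  using basis by (simp add: grad_div_eigenbasis_def)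

lemma eigenvalue_pos: "0 < (\<nu> j)\<^sup>2"
  using eigenvalue0_pos eigenvalue_ge order_less_le_trans by blast

text \<open>The weight is written as a power of nu_j^2 because positivity and monotonicity are
  assumed for the squares, while \<open>\<nu> j\<close> may have either sign.\<close>

lemma A_sp_iff: "F \<in> A_sp \<Omega> \<nu> q s \<longleftrightarrow> F \<in> \<A> \<Omega> \<and> summable (\<lambda>j. ((\<nu> j)\<^sup>2) ^ s * (F \<bullet> q j)\<^sup>2)"
  by (simp add: A_sp_def summable_on_UNIV_nonneg_real_iff power_mult)

lemma A_normsq_eq_suminf:
  assumes "F \<in> A_sp \<Omega> \<nu> q s"
  shows "A_normsq \<nu> q s F = (\<Sum>j. ((\<nu> j)\<^sup>2) ^ s * (F \<bullet> q j)\<^sup>2)"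
  using assms unfolding A_normsq_def A_sp_iff
  by (intro infsumI norm_summable_imp_has_sum summable_sums) (auto simp: power_mult)

text \<open>Since nu_j^2 >= nu_0^2 > 0, the quotient of the two weights is bounded below by
  \<open>((\<nu> 0)\<^sup>2) ^ (s - t)\<close>, also when nu_0^2 < 1.\<close>

lemma summable_weight_mono:
  assumes "summable (\<lambda>j. ((\<nu> j)\<^sup>2) ^ s * (a j)\<^sup>2)" and "t \<le> s"
  shows "summable (\<lambda>j. ((\<nu> j)\<^sup>2) ^ t * (a j)\<^sup>2)"
proof (rule summable_comparison_test')
  let ?c = "((\<nu> 0)\<^sup>2) ^ (s - t)"
  show "summable (\<lambda>j. inverse ?c * (((\<nu> j)\<^sup>2) ^ s * (a j)\<^sup>2))"
    using assms by (intro summable_mult)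
  fix j :: nat
  have "?c \<le> ((\<nu> j)\<^sup>2) ^ (s - t)"
    by (intro power_mono eigenvalue_ge) simp
  then have "?c * (((\<nu> j)\<^sup>2) ^ t * (a j)\<^sup>2) \<le> ((\<nu> j)\<^sup>2) ^ (s - t) * (((\<nu> j)\<^sup>2) ^ t * (a j)\<^sup>2)"
    by (intro mult_right_mono) auto
  also have "\<dots> = ((\<nu> j)\<^sup>2) ^ s * (a j)\<^sup>2"
    using \<open>t \<le> s\<close> by (simp add: mult.assoc[symmetric] power_add[symmetric])
  finally show "norm (((\<nu> j)\<^sup>2) ^ t * (a j)\<^sup>2) \<le> inverse ?c * (((\<nu> j)\<^sup>2) ^ s * (a j)\<^sup>2)"
    using eigenvalue0_pos by (simp add: divide_simps mult.commute)
qed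

lemma A_sp_diff:
  assumes "F \<in> A_sp \<Omega> \<nu> q s" "G \<in> A_sp \<Omega> \<nu> q s"
  shows "F - G \<in> A_sp \<Omega> \<nu> q s"
proof -
  have bound: "summable (\<lambda>j. 2 * (((\<nu> j)\<^sup>2) ^ s * (F \<bullet> q j)\<^sup>2) + 2 * (((\<nu> j)\<^sup>2) ^ s * (G \<bullet> q j)\<^sup>2))"
    using assms by (intro summable_add summable_mult) (simp_all add: A_sp_iff)
  have le: "norm (((\<nu> j)\<^sup>2) ^ s * ((F - G) \<bullet> q j)\<^sup>2) \<le>
      2 * (((\<nu> j)\<^sup>2) ^ s * (F \<bullet> q j)\<^sup>2) + 2 * (((\<nu> j)\<^sup>2) ^ s * (G \<bullet> q j)\<^sup>2)" for j
  proof -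
    have "((F - G) \<bullet> q j)\<^sup>2 \<le> 2 * (F \<bullet> q j)\<^sup>2 + 2 * (G \<bullet> q j)\<^sup>2"
      using sum_squares_bound[of "F \<bullet> q j" "- (G \<bullet> q j)"] by (simp add: inner_diff_left power2_diff)
    then have "((\<nu> j)\<^sup>2) ^ s * ((F - G) \<bullet> q j)\<^sup>2 \<le> ((\<nu> j)\<^sup>2) ^ s * (2 * (F \<bullet> q j)\<^sup>2 + 2 * (G \<bullet> q j)\<^sup>2)"
      by (intro mult_left_mono) auto
    then show ?thesis by (simp add: algebra_simps)
  qed
  have "summable (\<lambda>j. ((\<nu> j)\<^sup>2) ^ s * ((F - G) \<bullet> q j)\<^sup>2)"
    by (rule summable_comparison_test'[OF bound, where N = 0]) (rule le)
  moreover have "F - G \<in> \<A> \<Omega>"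
    using assms subspace_diff[OF orthonormal_basis_subspace[OF onb]] by (simp add: A_sp_iff)
  ultimately show ?thesis by (simp add: A_sp_iff)
qed

definition N_d_plus :: "real \<Rightarrow> (real^3) L2 \<Rightarrow> (real^3) L2" where
  "N_d_plus c F = N_d \<nu> q F + c *\<^sub>R F"

text \<open>The series in \<open>N_d\<close> is an unconditional \<open>suminf\<close>, meaningful
  only if it converges. Membership in the class of order s + 2 makes the sequence nu_j^2 (F, q_j)
  square summable, and Riesz-Fischer then permits reading coefficients off termwise.\<close>

lemma N_d_plus_coefficient:
  assumes "F \<in> A_sp \<Omega> \<nu> q (s + 2)"
  shows "N_d_plus c F \<in> \<A> \<Omega>" and "N_d_plus c F \<bullet> q j = (c - (\<nu> j)\<^sup>2) * (F \<bullet> q j)"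
proof -
  have FA: "F \<in> \<A> \<Omega>" using assms unfolding A_sp_iff by blast
  have "summable (\<lambda>j. ((\<nu> j)\<^sup>2) ^ 2 * (F \<bullet> q j)\<^sup>2)"
    using assms unfolding A_sp_iff by (intro summable_weight_mono[of "s + 2" _ 2]) auto
  then have "summable (\<lambda>j. ((\<nu> j)\<^sup>2 * (F \<bullet> q j))\<^sup>2)"
    by (simp add: power_mult_distrib)
  note RF = Riesz_Fischer[OF onb this]
  show "N_d_plus c F \<in> \<A> \<Omega>"
    unfolding N_d_plus_def N_d_def using RF(1) FA orthonormal_basis_subspace[OF onb]
    by (intro subspace_add subspace_neg subspace_scale)
  have "N_d \<nu> q F \<bullet> q j = - ((\<nu> j)\<^sup>2 * (F \<bullet> q j))"
    unfolding N_d_def inner_minus_left RF(2) ..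
  then show "N_d_plus c F \<bullet> q j = (c - (\<nu> j)\<^sup>2) * (F \<bullet> q j)"
    by (simp add: N_d_plus_def inner_add_left left_diff_distrib)
qed

text \<open>The smallest eigenvalue absorbs the constant term: |c| <= (|c| / nu_0^2) nu_j^2.\<close>

lemma abs_symbol_le: "\<bar>c - (\<nu> j)\<^sup>2\<bar> \<le> (\<bar>c\<bar> / (\<nu> 0)\<^sup>2 + 1) * (\<nu> j)\<^sup>2"
proof -
  have "\<bar>c\<bar> * (\<nu> 0)\<^sup>2 \<le> \<bar>c\<bar> * (\<nu> j)\<^sup>2"
    by (intro mult_left_mono eigenvalue_ge) simp
  then have "\<bar>c\<bar> \<le> \<bar>c\<bar> / (\<nu> 0)\<^sup>2 * (\<nu> j)\<^sup>2"
    using eigenvalue0_pos by (simp add: divide_simps)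
  moreover have "\<bar>c - (\<nu> j)\<^sup>2\<bar> \<le> \<bar>c\<bar> + (\<nu> j)\<^sup>2"
    using abs_triangle_ineq4[of c "(\<nu> j)\<^sup>2"] by simp
  ultimately show ?thesis
    by (simp add: distrib_right)
qed

text \<open>The squared multiplier costs two powers of nu_j^2, which is the shift from s to s + 2;
  for s = 2k it is the step from k to k + 1.\<close>

lemma N_d_plus_bounded:
  assumes F: "F \<in> A_sp \<Omega> \<nu> q (s + 2)"
  shows "N_d_plus c F \<in> A_sp \<Omega> \<nu> q s"
    and "A_normsq \<nu> q s (N_d_plus c F) \<le> (\<bar>c\<bar> / (\<nu> 0)\<^sup>2 + 1)\<^sup>2 * A_normsq \<nu> q (s + 2) F"
proof -
  let ?K = "\<bar>c\<bar> / (\<nu> 0)\<^sup>2 + 1"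
  have le: "((\<nu> j)\<^sup>2) ^ s * (N_d_plus c F \<bullet> q j)\<^sup>2 \<le> ?K\<^sup>2 * (((\<nu> j)\<^sup>2) ^ (s + 2) * (F \<bullet> q j)\<^sup>2)" for j
  proof -
    have "(c - (\<nu> j)\<^sup>2)\<^sup>2 \<le> (?K * (\<nu> j)\<^sup>2)\<^sup>2"
      using power_mono[OF abs_symbol_le abs_ge_zero, of c j 2] by simp
    then have "((\<nu> j)\<^sup>2) ^ s * (F \<bullet> q j)\<^sup>2 * (c - (\<nu> j)\<^sup>2)\<^sup>2 \<le> ((\<nu> j)\<^sup>2) ^ s * (F \<bullet> q j)\<^sup>2 * (?K * (\<nu> j)\<^sup>2)\<^sup>2"
      by (intro mult_left_mono) auto
    then show ?thesis
      by (simp add: N_d_plus_coefficient(2)[OF F] power_mult_distrib power_add mult_ac)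
  qed
  have sF: "summable (\<lambda>j. ?K\<^sup>2 * (((\<nu> j)\<^sup>2) ^ (s + 2) * (F \<bullet> q j)\<^sup>2))"
    using F by (intro summable_mult) (simp add: A_sp_iff)
  have sT: "summable (\<lambda>j. ((\<nu> j)\<^sup>2) ^ s * (N_d_plus c F \<bullet> q j)\<^sup>2)"
    by (rule summable_comparison_test'[OF sF, of 0]) (use le in simp)
  then show NF: "N_d_plus c F \<in> A_sp \<Omega> \<nu> q s"
    using N_d_plus_coefficient(1)[OF F] by (simp add: A_sp_iff)
  show "A_normsq \<nu> q s (N_d_plus c F) \<le> ?K\<^sup>2 * A_normsq \<nu> q (s + 2) F"
    using suminf_le[OF le sT sF] F
    unfolding A_normsq_eq_suminf[OF NF] A_normsq_eq_suminf[OF F]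
    by (subst (asm) suminf_mult) (simp_all only: A_sp_iff)
qed

text \<open>Comparing coefficients in the basis avoids subtracting the two defining series.\<close>

lemma N_d_plus_diff:
  assumes "F \<in> A_sp \<Omega> \<nu> q (s + 2)" "G \<in> A_sp \<Omega> \<nu> q (s + 2)"
  shows "N_d_plus c F - N_d_plus c G = N_d_plus c (F - G)"
proof (rule basis_coefficients_determine[OF onb])
  show "N_d_plus c F - N_d_plus c G \<in> \<A> \<Omega>"
    using assms by (intro subspace_diff[OF orthonormal_basis_subspace[OF onb]] N_d_plus_coefficient(1))
  show "N_d_plus c (F - G) \<in> \<A> \<Omega>"
    using A_sp_diff[OF assms] by (rule N_d_plus_coefficient(1))
  show "(N_d_plus c F - N_d_plus c G) \<bullet> q j = N_d_plus c (F - G) \<bullet> q j" for j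
    by (simp add: inner_diff_left N_d_plus_coefficient(2)[OF assms(1)] N_d_plus_coefficient(2)[OF assms(2)]
        N_d_plus_coefficient(2)[OF A_sp_diff[OF assms]] right_diff_distrib)
qed

text \<open>The bound by \<open>K\<close> does two things: with nu_j^2 > 0 it excludes zero
  multipliers, hence injectivity, and it makes division by the multipliers gain the two orders that
  a preimage requires.\<close>

lemma bij_betw_N_d_plus:
  assumes K: "\<And>j. (\<nu> j)\<^sup>2 \<le> K * \<bar>c - (\<nu> j)\<^sup>2\<bar>"
  shows "bij_betw (N_d_plus c) (A_sp \<Omega> \<nu> q (s + 2)) (A_sp \<Omega> \<nu> q s)"
proof (rule bij_betwI')
  have nz: "c - (\<nu> j)\<^sup>2 \<noteq> 0" for j
    using K[of j] eigenvalue_pos[of j] by auto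
  fix F G
  assume F: "F \<in> A_sp \<Omega> \<nu> q (s + 2)" and G: "G \<in> A_sp \<Omega> \<nu> q (s + 2)"
  show "(N_d_plus c F = N_d_plus c G) = (F = G)"
  proof
    assume "N_d_plus c F = N_d_plus c G"
    then have "F \<bullet> q j = G \<bullet> q j" for j
      using N_d_plus_coefficient(2)[OF F, of c j] N_d_plus_coefficient(2)[OF G, of c j] nz[of j] by simp
    then show "F = G"
      using F G by (intro basis_coefficients_determine[OF onb]) (auto simp: A_sp_iff)
  qed simp
next
  fix F assume "F \<in> A_sp \<Omega> \<nu> q (s + 2)"
  then show "N_d_plus c F \<in> A_sp \<Omega> \<nu> q s" by (rule N_d_plus_bounded)
next
  fix G assume G: "G \<in> A_sp \<Omega> \<nu> q s"
  have nz: "c - (\<nu> j)\<^sup>2 \<noteq> 0" for j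
    using K[of j] eigenvalue_pos[of j] by auto
  define a where "a j = (G \<bullet> q j) / (c - (\<nu> j)\<^sup>2)" for j
  have Ga: "G \<bullet> q j = (c - (\<nu> j)\<^sup>2) * a j" for j
    using nz by (simp add: a_def)
  have sa: "summable (\<lambda>j. ((\<nu> j)\<^sup>2) ^ (s + 2) * (a j)\<^sup>2)"
  proof (rule summable_comparison_test'[where N = 0])
    show "summable (\<lambda>j. K\<^sup>2 * (((\<nu> j)\<^sup>2) ^ s * (G \<bullet> q j)\<^sup>2))"
      using G by (intro summable_mult) (simp add: A_sp_iff)
    fix j :: nat
    have "((\<nu> j)\<^sup>2)\<^sup>2 \<le> (K * \<bar>c - (\<nu> j)\<^sup>2\<bar>)\<^sup>2"
      by (intro power_mono K) simp
    then have "((\<nu> j)\<^sup>2) ^ s * (a j)\<^sup>2 * ((\<nu> j)\<^sup>2)\<^sup>2 \<le> ((\<nu> j)\<^sup>2) ^ s * (a j)\<^sup>2 * (K * \<bar>c - (\<nu> j)\<^sup>2\<bar>)\<^sup>2"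
      by (intro mult_left_mono) auto
    then show "norm (((\<nu> j)\<^sup>2) ^ (s + 2) * (a j)\<^sup>2) \<le> K\<^sup>2 * (((\<nu> j)\<^sup>2) ^ s * (G \<bullet> q j)\<^sup>2)"
      by (simp add: Ga power_mult_distrib power_add mult_ac)
  qed
  have "summable (\<lambda>j. (a j)\<^sup>2)"
    using summable_weight_mono[OF sa, of 0] by simp
  note RF = Riesz_Fischer[OF onb this]
  define F where "F = (\<Sum>j. a j *\<^sub>R q j)"
  have F: "F \<in> A_sp \<Omega> \<nu> q (s + 2)"
    using RF sa by (simp add: A_sp_iff F_def)
  have "G = N_d_plus c F"
    using G N_d_plus_coefficient[OF F] RF(2)
    by (intro basis_coefficients_determine[OF onb]) (auto simp: A_sp_iff Ga F_def)
  then show "\<exists>F\<in>A_sp \<Omega> \<nu> q (s + 2). G = N_d_plus c F"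
    using F by blast
qed

lemma grad_div_plus_eq: "grad_div_plus \<nu> q c = map_prod (N_d_plus c) (\<lambda>w j. c *\<^sub>R w j)"
  by (auto simp: grad_div_plus_def N_d_plus_def fun_eq_iff)

lemma grad_div_plus_Lipschitz:
  assumes f: "f \<in> C_class \<Omega> \<nu> q lam (s + 2) m" and g: "g \<in> C_class \<Omega> \<nu> q lam (s + 2) m"
  shows "C_dist \<nu> q lam s m (grad_div_plus \<nu> q c f) (grad_div_plus \<nu> q c g)
    \<le> sqrt ((\<bar>c\<bar> / (\<nu> 0)\<^sup>2 + 1)\<^sup>2 + c\<^sup>2) * C_dist \<nu> q lam (s + 2) m f g"
proof -
  let ?K = "(\<bar>c\<bar> / (\<nu> 0)\<^sup>2 + 1)\<^sup>2"
  let ?a = "A_normsq \<nu> q (s + 2) (fst f - fst g)" and ?w = "W_normsq lam m (\<lambda>j. snd f j - snd g j)"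
  have fg: "fst f \<in> A_sp \<Omega> \<nu> q (s + 2)" "fst g \<in> A_sp \<Omega> \<nu> q (s + 2)"
    using f g by (auto simp: C_class_def)
  have "A_normsq \<nu> q s (N_d_plus c (fst f) - N_d_plus c (fst g)) \<le> ?K * ?a"
    using N_d_plus_bounded(2)[OF A_sp_diff[OF fg]] by (simp add: N_d_plus_diff[OF fg])
  moreover have "W_normsq lam m (\<lambda>j. c *\<^sub>R snd f j - c *\<^sub>R snd g j) = c\<^sup>2 * ?w"
    using W_normsq_scale[of lam m c "\<lambda>j. snd f j - snd g j"] by (simp only: scaleR_diff_right)
  moreover have "0 \<le> ?a"
    unfolding A_normsq_def by (intro infsum_nonneg) (simp only: power_mult, simp)
  moreover have "0 \<le> ?w"
    unfolding W_normsq_def by (intro infsum_nonneg) (simp add: power_int_mult)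
  \<comment> \<open>The constants of the two components are replaced by their sum; the nonnegative
    cross terms \<open>?K * ?w\<close> and \<open>c\<^sup>2 * ?a\<close> are what is added.\<close>
  ultimately have "A_normsq \<nu> q s (N_d_plus c (fst f) - N_d_plus c (fst g)) + W_normsq lam m (\<lambda>j. c *\<^sub>R snd f j - c *\<^sub>R snd g j)
      \<le> (?K + c\<^sup>2) * (?a + ?w)"
    using mult_nonneg_nonneg[OF zero_le_power2, of ?w "\<bar>c\<bar> / (\<nu> 0)\<^sup>2 + 1"]
      mult_nonneg_nonneg[OF zero_le_power2, of ?a c]
    unfolding distrib_left distrib_right[of ?K] by linarith
  then show ?thesis
    by (simp add: C_dist_def grad_div_plus_eq real_sqrt_mult[symmetric])
qed

end

section \<open>The spectrum\<close>

lemma zero_in_L2_on: "0 \<in> L2_on \<Omega>"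
  unfolding L2_on_def using sq_integrable_zero
  by (auto simp: L2_of_def zero_L2.abs_eq intro!: exI[of _ "\<lambda>x. 0"])

lemma zero_in_Sp_neg_grad_div:
  assumes "rot_eigenbasis \<Omega> lam qp qm"
  shows "0 \<in> Sp_neg_grad_div \<Omega>"
proof -
  have V: "qp 0 \<in> V0 \<Omega>" and tr: "normal_trace_zero \<Omega> (qp 0)"
    using assms by (auto simp: rot_eigenbasis_def S_graph_def)
  have "case_sum qp qm (Inl 0) \<bullet> case_sum qp qm (Inl 0) = 1"
    using assms unfolding rot_eigenbasis_def orthonormal_basis_def by presburger
  then have "qp 0 \<noteq> 0" by auto
  \<comment> \<open>Fields of \<open>V0\<close> are orthogonal to all weak gradients; restricted to
    gradients of test functions, this is the weak form of vanishing divergence.\<close>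
  have "L2_of (gradient \<phi>) \<in> \<A> \<Omega>" if "\<phi> \<in> test_functions \<Omega>" for \<phi>
    using has_weak_grad_test_function[OF that] by (auto simp: gradient_fields_def)
  then have "qp 0 \<bullet> L2_of (gradient \<phi>) = 0" if "\<phi> \<in> test_functions \<Omega>" for \<phi>
    using V that by (auto simp: V0_def orthogonal_comp_def orthogonal_def inner_commute[of "qp 0"])
  then have "has_weak_div \<Omega> (qp 0) 0"
    using V by (simp add: zero_in_L2_on has_weak_div_def V0_def)
  moreover have "has_weak_grad \<Omega> 0 0"
    by (simp add: zero_in_L2_on has_weak_grad_def)
  ultimately have "neg_grad_div_eigen \<Omega> 0 (qp 0)"
    using tr unfolding neg_grad_div_eigen_def by (intro conjI exI[of _ 0]) simp_all
  with \<open>qp 0 \<noteq> 0\<close> show ?thesis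
    by (auto simp: Sp_neg_grad_div_def)
qed

section \<open>Growth of the eigenvalues and the gap around a nonspectral value\<close>

context grad_div_basis
begin

lemma eigenvalue_in_Sp: "(\<nu> j)\<^sup>2 \<in> Sp_neg_grad_div \<Omega>"
proof -
  have "q j \<bullet> q j = 1"
    using onb by (simp add: orthonormal_basis_def)
  then have "q j \<noteq> 0" by auto
  then show ?thesis
    using basis by (auto simp: Sp_neg_grad_div_def grad_div_eigenbasis_def)
qed

text \<open>The field kept is the divergence from the trace condition; it inherits the gradient of
  the other one through \<open>has_weak_grad_transfer_div\<close>.\<close>

lemma divergence_of_eigenfields:
  assumes "open \<Omega>"
  obtains D where "\<And>j. has_weak_grad \<Omega> (D j) (- ((\<nu> j)\<^sup>2 *\<^sub>R q j))"
    "\<And>j H G. has_weak_grad \<Omega> H G \<Longrightarrow> q j \<bullet> G + D j \<bullet> H = 0"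
proof -
  have "\<exists>D. has_weak_grad \<Omega> D (- ((\<nu> j)\<^sup>2 *\<^sub>R q j)) \<and> (\<forall>H G. has_weak_grad \<Omega> H G \<longrightarrow> q j \<bullet> G + D \<bullet> H = 0)" for j
  proof -
    have "neg_grad_div_eigen \<Omega> ((\<nu> j)\<^sup>2) (q j)"
      using basis by (simp add: grad_div_eigenbasis_def)
    then obtain D G D' where D: "has_weak_div \<Omega> (q j) D" "has_weak_grad \<Omega> D G" "- G = (\<nu> j)\<^sup>2 *\<^sub>R q j"
      and D': "has_weak_div \<Omega> (q j) D'" "\<forall>H G. has_weak_grad \<Omega> H G \<longrightarrow> q j \<bullet> G + D' \<bullet> H = 0"
      unfolding neg_grad_div_eigen_def normal_trace_zero_def by blast
    have "G = - ((\<nu> j)\<^sup>2 *\<^sub>R q j)"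
      using D(3) by (metis minus_minus)
    with has_weak_grad_transfer_div[OF assms D(1) D'(1) D(2)] D'(2) show ?thesis by blast
  qed
  then show ?thesis using that by metis
qed

text \<open>The divergences of the eigenfields are orthogonal with squared norms \<open>(\<nu> j)\<^sup>2\<close>, so for
  bounded eigenvalues Bessel's inequality bounds every gradient by its potential.\<close>

lemma gradient_bounded_if_eigenvalues_bounded:
  assumes "open \<Omega>" and L: "\<And>j. (\<nu> j)\<^sup>2 \<le> L" and HG: "has_weak_grad \<Omega> H G"
  shows "(norm G)\<^sup>2 \<le> L * (norm H)\<^sup>2"
proof -
  obtain D where D: "\<And>j. has_weak_grad \<Omega> (D j) (- ((\<nu> j)\<^sup>2 *\<^sub>R q j))"
    and tr: "\<And>j H G. has_weak_grad \<Omega> H G \<Longrightarrow> q j \<bullet> G + D j \<bullet> H = 0"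
    using divergence_of_eigenfields[OF \<open>open \<Omega>\<close>] by blast
  have on: "q i \<bullet> q j = (if i = j then 1 else 0)" for i j
    using onb by (simp add: orthonormal_basis_def)
  have L0: "0 \<le> L" using L[of 0] zero_le_power2[of "\<nu> 0"] by linarith
  \<comment> \<open>The trace identity of \<open>q i\<close> is tested with the potential
    \<open>D j\<close> and its gradient.\<close>
  have DD: "D i \<bullet> D j = (if i = j then (\<nu> j)\<^sup>2 else 0)" for i j
    using tr[OF D, of i j] on[of i j] by (auto split: if_splits)
  define c where "c j = D j \<bullet> H" for j
  have Gc: "G \<bullet> q j = - c j" for j
    using tr[OF HG, of j] by (simp add: c_def inner_commute)
  have bessel: "(\<Sum>j<n. (c j)\<^sup>2) \<le> L * (norm H)\<^sup>2" for n
  proof -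
    \<comment> \<open>Bessel's inequality without normalising the \<open>D j\<close>: (x, H) equals
      the sum S of the squared coefficients and |x|^2 <= L S, so Cauchy-Schwarz gives S^2 <= L S
      |H|^2.\<close>
    define x where "x = (\<Sum>j<n. c j *\<^sub>R D j)"
    let ?S = "\<Sum>j<n. (c j)\<^sup>2"
    have S0: "0 \<le> ?S" by (simp add: sum_nonneg)
    have xH: "x \<bullet> H = ?S"
      by (simp add: x_def inner_sum_left c_def power2_eq_square)
    have xD: "x \<bullet> D j = c j * (\<nu> j)\<^sup>2" if "j < n" for j
      using that by (simp add: x_def inner_sum_left DD if_distrib cong: if_cong)
    have "x \<bullet> x = (\<Sum>j<n. c j * (x \<bullet> D j))"
      by (subst (2) x_def) (simp add: inner_sum_right)
    also have "\<dots> = (\<Sum>j<n. (c j)\<^sup>2 * (\<nu> j)\<^sup>2)"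
      by (intro sum.cong refl) (simp add: xD power2_eq_square)
    also have "\<dots> \<le> (\<Sum>j<n. (c j)\<^sup>2 * L)"
      by (intro sum_mono mult_left_mono L) simp
    finally have xx: "x \<bullet> x \<le> ?S * L"
      by (simp add: sum_distrib_right)
    have "?S * ?S \<le> (x \<bullet> x) * (H \<bullet> H)"
      using Cauchy_Schwarz_ineq[of x H] by (simp add: xH power2_eq_square)
    also have "\<dots> \<le> (?S * L) * (H \<bullet> H)"
      by (intro mult_right_mono xx) simp
    finally have "?S * ?S \<le> ?S * (L * (norm H)\<^sup>2)"
      by (simp only: power2_norm_eq_inner mult.assoc)
    then show ?thesis
      using S0 L0 by (cases "?S = 0") (auto simp: mult_le_cancel_left)
  qed
  have "G \<in> \<A> \<Omega>"
    using HG by (auto simp: gradient_fields_def)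
  then have "(\<lambda>n. \<Sum>j<n. (G \<bullet> q j) *\<^sub>R q j) \<longlonglongrightarrow> G"
    using orthonormal_basis_expansion[OF onb] by (simp add: sums_def)
  then have "(\<lambda>n. (norm (\<Sum>j<n. (G \<bullet> q j) *\<^sub>R q j))\<^sup>2) \<longlonglongrightarrow> (norm G)\<^sup>2"
    by (intro tendsto_intros)
  then show ?thesis
  proof (rule LIMSEQ_le_const2, intro exI[of _ 0] allI impI)
    show "(norm (\<Sum>j<n. (G \<bullet> q j) *\<^sub>R q j))\<^sup>2 \<le> L * (norm H)\<^sup>2" for n
      unfolding orthonormal_partial_sum(2)[OF on finite_lessThan] using bessel[of n] by (simp add: Gc)
  qed
qed

lemma eigenvalues_unbounded:
  assumes "open \<Omega>" "\<Omega> \<noteq> {}"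
  shows "\<exists>j. L < (\<nu> j)\<^sup>2"
proof (rule ccontr)
  assume "\<not> (\<exists>j. L < (\<nu> j)\<^sup>2)"
  then have L: "(\<nu> j)\<^sup>2 \<le> L" for j
    by (simp add: not_less)
  have L0: "0 \<le> L" using L[of 0] zero_le_power2[of "\<nu> 0"] by linarith
  obtain \<phi> :: "real^3 \<Rightarrow> real" where \<phi>: "\<phi> \<in> test_functions \<Omega>"
    "L * (norm (L2_of \<phi>))\<^sup>2 < (norm (L2_of (gradient \<phi>)))\<^sup>2"
    using exists_test_function_steep_gradient[OF assms L0] by blast
  show False
    using gradient_bounded_if_eigenvalues_bounded[OF \<open>open \<Omega>\<close> L has_weak_grad_test_function[OF \<phi>(1)]] \<phi>(2)
    by linarith
qed

lemma eigenvalue_gap: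
  assumes "open \<Omega>" "\<Omega> \<noteq> {}" and ne: "\<And>j. c \<noteq> (\<nu> j)\<^sup>2"
  obtains K where "\<And>j. (\<nu> j)\<^sup>2 \<le> K * \<bar>c - (\<nu> j)\<^sup>2\<bar>"
proof -
  obtain N where N: "2 * \<bar>c\<bar> < (\<nu> N)\<^sup>2"
    using eigenvalues_unbounded[OF assms(1,2)] by blast
  \<comment> \<open>From index N on, nu_j^2 > 2 |c| gives |c - nu_j^2| >= nu_j^2 / 2, hence the
    constant 2. The finitely many earlier ratios are each at most their sum
    \<open>S\<close>.\<close>
  define S where "S = (\<Sum>j<N. (\<nu> j)\<^sup>2 / \<bar>c - (\<nu> j)\<^sup>2\<bar>)"
  have S0: "0 \<le> S"
    unfolding S_def by (intro sum_nonneg) simp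
  have "(\<nu> j)\<^sup>2 \<le> (2 + S) * \<bar>c - (\<nu> j)\<^sup>2\<bar>" for j
  proof (cases "j < N")
    case True
    have "(\<nu> j)\<^sup>2 / \<bar>c - (\<nu> j)\<^sup>2\<bar> \<le> S"
      unfolding S_def by (rule member_le_sum) (use True in auto)
    then have "(\<nu> j)\<^sup>2 / \<bar>c - (\<nu> j)\<^sup>2\<bar> \<le> 2 + S" by simp
    then show ?thesis
      using ne[of j] by (simp add: pos_divide_le_eq)
  next
    case False
    then have "(\<nu> N)\<^sup>2 \<le> (\<nu> j)\<^sup>2"
      using basis monoD[of "\<lambda>j. (\<nu> j)\<^sup>2" N j] by (simp add: grad_div_eigenbasis_def)
    then have "(\<nu> j)\<^sup>2 \<le> 2 * \<bar>c - (\<nu> j)\<^sup>2\<bar>"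
      using N abs_ge_self[of c] abs_ge_minus_self[of "c - (\<nu> j)\<^sup>2"] by (simp add: abs_if split: if_splits)
    also have "\<dots> \<le> (2 + S) * \<bar>c - (\<nu> j)\<^sup>2\<bar>"
      using S0 by (intro mult_right_mono) auto
    finally show ?thesis .
  qed
  then show ?thesis using that by blast
qed

end

theorem mainTheorem8:
  fixes \<Omega> :: "(real^3) set"
    and \<nu>s lam :: "nat \<Rightarrow> real"
    and q qp qm :: "nat \<Rightarrow> (real^3) L2"
    and \<nu> :: real and k :: nat and m :: int
  assumes "smooth_ball_domain \<Omega>"
    and "grad_div_eigenbasis \<Omega> \<nu>s q"
    and "rot_eigenbasis \<Omega> lam qp qm"
    and "\<nu>\<^sup>2 \<notin> Sp_neg_grad_div \<Omega>"
    and "k > 0"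
  shows "bij_betw (grad_div_plus \<nu>s q (\<nu>\<^sup>2))
           (C_class \<Omega> \<nu>s q lam (2 * (k + 1)) m) (C_class \<Omega> \<nu>s q lam (2 * k) m) \<and>
         continuous_map (C_topology \<Omega> \<nu>s q lam (2 * (k + 1)) m) (C_topology \<Omega> \<nu>s q lam (2 * k) m)
           (grad_div_plus \<nu>s q (\<nu>\<^sup>2))"
proof -
  interpret grad_div_basis \<Omega> \<nu>s q
    by unfold_locales (rule assms(2))
  let ?T = "grad_div_plus \<nu>s q (\<nu>\<^sup>2)" and ?C = "\<lambda>s. C_class \<Omega> \<nu>s q lam s m" and ?d = "\<lambda>s. C_dist \<nu>s q lam s m"
  have s: "2 * (k + 1) = 2 * k + 2" by simp
  have \<Omega>: "open \<Omega>" "\<Omega> \<noteq> {}"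
    using assms(1) by (auto simp: smooth_ball_domain_def)
  have "\<nu>\<^sup>2 \<noteq> (\<nu>s j)\<^sup>2" for j
    using assms(4) eigenvalue_in_Sp by metis
  then obtain K where K: "\<And>j. (\<nu>s j)\<^sup>2 \<le> K * \<bar>\<nu>\<^sup>2 - (\<nu>s j)\<^sup>2\<bar>"
    using eigenvalue_gap[OF \<Omega>] by metis
  have "\<nu>\<^sup>2 \<noteq> 0"
    using assms(4) zero_in_Sp_neg_grad_div[OF assms(3)] by metis
  then have bij: "bij_betw ?T (?C (2 * k + 2)) (?C (2 * k))"
    unfolding grad_div_plus_eq C_class_def
    by (intro bij_betw_map_prod bij_betw_N_d_plus[OF K] bij_betw_scale_W_sp)
  have M: "Metric_space (?C s) (?d s)" for s
    by (rule Metric_space_C[OF assms(2,3)])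
  \<comment> \<open>\<open>C_topology\<close> is the topology of the metric \<open>C_dist\<close>,
    so the Lipschitz bound for differences is exactly what continuity takes.\<close>
  have "Lipschitz_continuous_map (metric (?C (2 * k + 2), ?d (2 * k + 2))) (metric (?C (2 * k), ?d (2 * k))) ?T"
    unfolding Lipschitz_continuous_map_def Metric_space.mspace_metric[OF M] Metric_space.mdist_metric[OF M]
    using bij_betw_imp_funcset[OF bij] grad_div_plus_Lipschitz by blast
  then have "continuous_map (C_topology \<Omega> \<nu>s q lam (2 * k + 2) m) (C_topology \<Omega> \<nu>s q lam (2 * k) m) ?T"
    using Lipschitz_continuous_imp_continuous_map
    by (force simp: C_topology_def Metric_space.mtopology_of[OF M])
  with bij show ?thesis
    unfolding s by blast
qed

end
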